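(* Let $n, r \in \mathbb{N}$ with $n > 2r$, let $M$ be the Markov chain on types $\{0,1,\ldots,r\}$ induced by the skewed $r$-random to top shuffle, let $Q$ be its transition matrix, and let $\pi$ be its invariant distribution. For each eigenvalue $\lambda \neq 1$ of $Q$, let $\phi^{(\lambda)} \in \mathbb{R}^{r+1}$ be a row vector with $\phi^{(\lambda)} Q = \lambda \phi^{(\lambda)}$ and $\langle \phi^{(\lambda)}, \phi^{(\lambda)}\rangle = 1$, where $\langle \vartheta, \phi \rangle = \sum_{z=0}^r \vartheta_z\phi_z/\pi_z$. Let $\vartheta$ be an arbitrary probability distribution on $\{0,1,\ldots,r\}$. Then there exist unique scalars $c_\lambda \in \mathbb{R}$ such that $\vartheta = \pi + \sum_{\lambda \neq 1} c_\lambda \phi^{(\lambda)}$, and for every $t \in \mathbb{N}_0$, \[ \sum_{x=0}^r \frac{\bigl(\mathbb{P}[M_t = x \mid M_0 \sim \vartheta] - \pi_x\bigr)^2}{\pi_x} = \sum_{\lambda \neq 1} c_\lambda^2 \lambda^{2t} \] and \[ \Bigl\| \bigl(\mathbb{P}[M_t = x \mid M_0 \sim \vartheta]\bigr)_{0 \le x \le r} - \pi \Bigr\|_{\mathrm{TV}} \le \frac{\sqrt{r+1}}{2}\sqrt{\sum_{\lambda \neq 1} c_\lambda^2 \lambda^{2t}}. \] Here the sums are over the eigenvalues $\lambda \ne 1$ of $Q$.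
   Context: Permutations in $\mathrm{Sym}_n$ act on the right on $\{1,\ldots,n\}$, and are composed accordingly. Skewed $r$-random to top shuffle: for each $r$-subset $R$ of $\{r+1,\ldots,n\}$ let $d_R \in \mathrm{Sym}_n$ be the permutation of positions that maps $R$ to $\{1,\ldots,r\}$ preserving order, and maps $\{1,\ldots,n\}\setminus R$ to $\{r+1,\ldots,n\}$ preserving order. Let $D$ be the set of all such $d_R$. The shuffle is the random walk on $\mathrm{Sym}_n$ that moves from $g$ to $gd$ with $d$ chosen uniformly at random from $D$. Let $H = \mathrm{Sym}_r \times \mathrm{Sym}_{n-r}$ be the stabiliser in $\mathrm{Sym}_n$ of $(\{1,\ldots,r\},\{r+1,\ldots,n\})$. The double cosets in $H\backslash \mathrm{Sym}_n/H$ are indexed by $\{0,1,\ldots,r\}$: $g$ has type $x$ if and only if $\{1,\ldots,r\}g \cap \{1,\ldots,r\}$ has size $x$. The shuffle induces a time-homogeneous Markov chain $M$ on types, with transition matrix \[ Q_{xz} = \binom{r-x}{z}\binom{n-2r+x}{r-z}\Big/\binom{n-r}{r}, \qquad x,z \in \{0,1,\ldots,r\}, \] whose unique invariant distribution is $\pi_x = \binom{r}{x}\binom{n-r}{r-x}/\binom{n}{r}$ and whose eigenvalues are $(-1)^{r-x}\binom{r}{x}/\binom{n-r}{r-x}$ for $x \in \{0,1,\ldots,r\}$. Vectors in $\mathbb{R}^{r+1}$ are row vectors with positions indexed from $0$ to $r$. $M_t$ is the state of $M$ at time $t$, and $M_0 \sim \vartheta$ means that $M_0$ has distribution $\vartheta$.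 The total variation distance between probability vectors $p, q$ is $\|p-q\|_{\mathrm{TV}} = \frac12\sum_x |p_x - q_x|$. *)

theory Defs
  imports
    "HOL-Probability.Probability"
    "HOL-Combinatorics.Permutations"
    "Jordan_Normal_Form.Spectral_Radius"
begin

text \<open>
  Permutations act on the right, so the group product \<open>g d\<close> is the function \<open>d \<circ> g\<close> and
  the image of \<open>{1, \<dots>, r}\<close> under \<open>g\<close> is \<open>g ` {1..r}\<close>.
\<close>

definition maps_to_top :: "nat \<Rightarrow> nat \<Rightarrow> nat set \<Rightarrow> (nat \<Rightarrow> nat) \<Rightarrow> bool" where
  "maps_to_top n r R d \<longleftrightarrow> d permutes {1..n}
     \<and> d ` R = {1..r} \<and> strict_mono_on R d
     \<and> d ` ({1..n} - R) = {r+1..n} \<and> strict_mono_on ({1..n} - R) d"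

definition skewed_perms :: "nat \<Rightarrow> nat \<Rightarrow> (nat \<Rightarrow> nat) set" where
  "skewed_perms n r = {d. \<exists>R. R \<subseteq> {r+1..n} \<and> card R = r \<and> maps_to_top n r R d}"

definition shuffle_step :: "nat \<Rightarrow> nat \<Rightarrow> (nat \<Rightarrow> nat) \<Rightarrow> (nat \<Rightarrow> nat) pmf" where
  "shuffle_step n r g = map_pmf (\<lambda>d. d \<circ> g) (pmf_of_set (skewed_perms n r))"

definition perm_type :: "nat \<Rightarrow> (nat \<Rightarrow> nat) \<Rightarrow> nat" where
  "perm_type r g = card (g ` {1..r} \<inter> {1..r})"

text \<open>
  The induced kernel on types: take one step of the shuffle from a uniformly random permutation
  of type \<open>x\<close> and record the new type.  By \<open>shuffle_induces_type_step\<close> below, every permutation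
  of type \<open>x\<close> gives the same distribution.
\<close>

definition type_step :: "nat \<Rightarrow> nat \<Rightarrow> nat \<Rightarrow> nat pmf" where
  "type_step n r x = map_pmf (perm_type r)
     (bind_pmf (pmf_of_set {g. g permutes {1..n} \<and> perm_type r g = x}) (shuffle_step n r))"

definition type_matrix :: "nat \<Rightarrow> nat \<Rightarrow> real mat" where
  "type_matrix n r = Matrix.mat (r+1) (r+1) (\<lambda>(x, z). pmf (type_step n r x) z)"

text \<open>
  Time-homogeneous Markov chain with transition kernel \<open>K\<close>, for countable state spaces.  The
  Markov property is stated in product form to avoid conditioning on null events.
\<close>

definition markov_chain :: "'w measure \<Rightarrow> (nat \<Rightarrow> 'w \<Rightarrow> 's) \<Rightarrow> ('s \<Rightarrow> 's pmf) \<Rightarrow> bool" where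
  "markov_chain \<Omega> M K \<longleftrightarrow> prob_space \<Omega>
     \<and> (\<forall>t. M t \<in> measurable \<Omega> (count_space UNIV))
     \<and> (\<forall>t s. \<P>(\<omega> in \<Omega>. \<forall>i\<le>Suc t. M i \<omega> = s i)
            = \<P>(\<omega> in \<Omega>. \<forall>i\<le>t. M i \<omega> = s i) * pmf (K (s t)) (s (Suc t)))"

definition prob_vec :: "nat \<Rightarrow> real vec \<Rightarrow> bool" where
  "prob_vec m p \<longleftrightarrow> p \<in> carrier_vec m \<and> (\<forall>x<m. vec_index p x \<ge> 0) \<and> (\<Sum>x<m. vec_index p x) = 1"

text \<open>Vectors are row vectors, so the product \<open>p Q\<close> is written \<open>transpose_mat Q *\<^sub>v p\<close>.\<close>

definition invariant_distribution :: "real mat \<Rightarrow> real vec \<Rightarrow> bool" where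
  "invariant_distribution Q p \<longleftrightarrow> prob_vec (dim_row Q) p \<and> transpose_mat Q *\<^sub>v p = p"

definition weighted_inner :: "real vec \<Rightarrow> real vec \<Rightarrow> real vec \<Rightarrow> real" where
  "weighted_inner p u v = (\<Sum>z<dim_vec p. vec_index u z * vec_index v z / vec_index p z)"

definition tv_dist :: "real vec \<Rightarrow> real vec \<Rightarrow> real" where
  "tv_dist p q = (\<Sum>x<dim_vec p. \<bar>vec_index p x - vec_index q x\<bar>) / 2"


subsection \<open>The shuffle induces the chain on types\<close>

definition rank_perm :: "nat \<Rightarrow> nat \<Rightarrow> nat set \<Rightarrow> nat \<Rightarrow> nat" where
  "rank_perm n r R i =
     (if i \<in> R then card {j \<in> R. j \<le> i}
      else if i \<in> {1..n} then r + card {j \<in> {1..n} - R. j \<le> i} else i)"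

lemma rank_strict_mono:
  fixes A :: "nat set"
  assumes "finite A"
  shows "strict_mono_on A (\<lambda>i. card {j \<in> A. j \<le> i})"
proof (rule strict_mono_onI)
  fix i k assume ik: "i \<in> A" "k \<in> A" "i < k"
  have "k \<in> {j \<in> A. j \<le> k}" "k \<notin> {j \<in> A. j \<le> i}" using ik by auto
  moreover have "{j \<in> A. j \<le> i} \<subseteq> {j \<in> A. j \<le> k}" using ik by auto
  ultimately have "{j \<in> A. j \<le> i} \<subset> {j \<in> A. j \<le> k}" by blast
  then show "card {j \<in> A. j \<le> i} < card {j \<in> A. j \<le> k}"
    using assms by (intro psubset_card_mono) auto
qed

lemma rank_image:
  fixes A :: "nat set"
  assumes "finite A"
  shows "(\<lambda>i. card {j \<in> A. j \<le> i}) ` A = {1..card A}"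
proof (rule card_subset_eq)
  show "(\<lambda>i. card {j \<in> A. j \<le> i}) ` A \<subseteq> {1..card A}"
  proof
    fix y assume "y \<in> (\<lambda>i. card {j \<in> A. j \<le> i}) ` A"
    then obtain i where i: "i \<in> A" "y = card {j \<in> A. j \<le> i}" by blast
    have "y > 0" using i assms by (auto simp: card_gt_0_iff)
    moreover have "y \<le> card A" using i assms by (auto intro: card_mono)
    ultimately show "y \<in> {1..card A}" by auto
  qed
  have "inj_on (\<lambda>i. card {j \<in> A. j \<le> i}) A"
    using rank_strict_mono[OF assms] by (rule strict_mono_on_imp_inj_on)
  then show "card ((\<lambda>i. card {j \<in> A. j \<le> i}) ` A) = card {1..card A}"
    by (simp add: card_image)
qed simp

lemma strict_mono_on_rank:
  fixes A :: "nat set"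
  assumes "finite A" "strict_mono_on A d" "d ` A = {Suc s..m}" "i \<in> A"
  shows "d i = s + card {j \<in> A. j \<le> i}"
proof -
  have inj: "inj_on d A" using assms(2) by (rule strict_mono_on_imp_inj_on)
  have le: "d j \<le> d i \<longleftrightarrow> j \<le> i" if "j \<in> A" for j
    using assms(2,4) that by (metis linorder_not_le order_le_less strict_mono_onD)
  have "d i \<in> {Suc s..m}" using assms(3,4) by blast
  moreover have "d ` {j \<in> A. j \<le> i} = {y \<in> d ` A. y \<le> d i}" using le by auto
  ultimately have "d ` {j \<in> A. j \<le> i} = {Suc s..d i}" using assms(3) by auto
  moreover have "card (d ` {j \<in> A. j \<le> i}) = card {j \<in> A. j \<le> i}"
    by (rule card_image) (rule inj_on_subset[OF inj], auto)
  ultimately have "d i - s = card {j \<in> A. j \<le> i}" by simp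
  moreover have "s \<le> d i" using \<open>d i \<in> {Suc s..m}\<close> by simp
  ultimately show ?thesis by linarith
qed

lemma maps_to_top_rank_perm:
  assumes "R \<subseteq> {1..n}" "card R = r"
  shows "maps_to_top n r R (rank_perm n r R)"
proof -
  let ?d = "rank_perm n r R" and ?C = "{1..n} - R"
  have fin: "finite R" using assms(1) finite_subset by blast
  have rn: "r \<le> n" using card_mono[OF _ assms(1)] assms(2) by simp
  have cC: "card ?C = n - r" using assms fin by (simp add: card_Diff_subset)
  have eqR: "?d i = card {j \<in> R. j \<le> i}" if "i \<in> R" for i using that by (simp add: rank_perm_def)
  have eqC: "?d i = r + card {j \<in> ?C. j \<le> i}" if "i \<in> ?C" for i
    using that by (simp add: rank_perm_def)
  have imR: "?d ` R = {1..r}"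
    using rank_image[OF fin] assms(2) eqR by (metis (no_types, lifting) image_cong)
  have "?d ` ?C = (+) r ` (\<lambda>i. card {j \<in> ?C. j \<le> i}) ` ?C"
    using eqC unfolding image_image by (intro image_cong) auto
  also have "\<dots> = {r+1..n}" using rank_image[of ?C] cC rn by simp
  finally have imC: "?d ` ?C = {r+1..n}" .
  have smR: "strict_mono_on R ?d"
    using rank_strict_mono[OF fin] eqR by (simp add: monotone_on_def)
  have smC: "strict_mono_on ?C ?d"
    using rank_strict_mono[of ?C] eqC by (simp add: monotone_on_def)
  have "?d ` {1..n} = ?d ` R \<union> ?d ` ?C" using assms(1) by (metis Un_Diff_cancel image_Un sup.absorb2)
  then have im: "?d ` {1..n} = {1..n}" unfolding imR imC using rn by auto
  then have "bij_betw ?d {1..n} {1..n}"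
    by (simp add: bij_betw_def eq_card_imp_inj_on)
  moreover have "?d i = i" if "i \<notin> {1..n}" for i
    using that assms(1) unfolding rank_perm_def by auto
  ultimately have "?d permutes {1..n}" by (rule bij_imp_permutes) 
  then show ?thesis unfolding maps_to_top_def using imR imC smR smC by blast
qed

lemma maps_to_top_unique:
  assumes "R \<subseteq> {1..n}" "maps_to_top n r R d"
  shows "d = rank_perm n r R"
proof
  fix i
  have d: "d permutes {1..n}" "d ` R = {1..r}" "strict_mono_on R d"
     "d ` ({1..n} - R) = {r+1..n}" "strict_mono_on ({1..n} - R) d"
    using assms(2) unfolding maps_to_top_def by auto
  have "finite R" using assms(1) finite_subset by blast
  then have R: "d i = card {j \<in> R. j \<le> i}" if "i \<in> R"
    using strict_mono_on_rank[of R d 0 r i] d that by simp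
  have C: "d i = r + card {j \<in> {1..n} - R. j \<le> i}" if "i \<in> {1..n} - R"
    using strict_mono_on_rank[of "{1..n} - R" d r n i] d that by simp
  show "d i = rank_perm n r R i"
    using R C permutes_not_in[OF d(1)] unfolding rank_perm_def by auto
qed

definition r_subsets :: "nat \<Rightarrow> nat \<Rightarrow> nat set set" where
  "r_subsets n r = {R. R \<subseteq> {r+1..n} \<and> card R = r}"

lemma r_subsets_sub: "R \<in> r_subsets n r \<Longrightarrow> R \<subseteq> {1..n} \<and> card R = r"
  unfolding r_subsets_def by force

lemma finite_r_subsets: "finite (r_subsets n r)"
  unfolding r_subsets_def by (rule finite_subset[of _ "Pow {r+1..n}"]) auto

lemma card_r_subsets: "card (r_subsets n r) = (n - r) choose r"
  unfolding r_subsets_def using n_subsets[of "{r+1..n}" r] by simp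

lemma skewed_perms_eq: "skewed_perms n r = rank_perm n r ` r_subsets n r"
proof (intro equalityI subsetI)
  fix d assume "d \<in> skewed_perms n r"
  then obtain R where R: "R \<in> r_subsets n r" "maps_to_top n r R d"
    unfolding skewed_perms_def r_subsets_def by blast
  then show "d \<in> rank_perm n r ` r_subsets n r"
    using maps_to_top_unique r_subsets_sub by blast
next
  fix d assume "d \<in> rank_perm n r ` r_subsets n r"
  then obtain R where R: "R \<in> r_subsets n r" "d = rank_perm n r R" by blast
  then have "maps_to_top n r R d" using maps_to_top_rank_perm r_subsets_sub by blast
  then show "d \<in> skewed_perms n r"
    using R(1) unfolding skewed_perms_def r_subsets_def by blast
qed

lemma maps_to_top_vimage:
  assumes "maps_to_top n r R d" "R \<subseteq> {1..n}"
  shows "d i \<in> {1..r} \<longleftrightarrow> i \<in> R"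
proof -
  have "inj d" "d ` R = {1..r}"
    using assms(1) permutes_inj unfolding maps_to_top_def by auto
  then show ?thesis by (metis inj_image_mem_iff)
qed

lemma inj_on_rank_perm: "inj_on (rank_perm n r) (r_subsets n r)"
proof (rule inj_onI)
  fix R S assume RS: "R \<in> r_subsets n r" "S \<in> r_subsets n r" "rank_perm n r R = rank_perm n r S"
  have "i \<in> R \<longleftrightarrow> i \<in> S" for i
    using maps_to_top_vimage maps_to_top_rank_perm r_subsets_sub RS by metis
  then show "R = S" by blast
qed

lemma card_inter_count:
  assumes "A \<subseteq> {1..n}" "card A = r" "card (A \<inter> {1..r}) = x" "2 * r < n"
  shows "card {R \<in> r_subsets n r. card (A \<inter> R) = z}
           = ((r - x) choose z) * ((n - 2 * r + x) choose (r - z))"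
proof -
  let ?U = "{r+1..n}" let ?B = "A \<inter> ?U" and ?C = "?U - A"
  have fA: "finite A" using assms(1) finite_subset by blast
  have "card A = card (A \<inter> {1..r}) + card ?B"
  proof -
    have "A = (A \<inter> {1..r}) \<union> ?B" "(A \<inter> {1..r}) \<inter> ?B = {}" using assms(1) by auto
    then show ?thesis using fA by (metis card_Un_disjoint finite_Int)
  qed
  then have cB: "card ?B = r - x" and xr: "x \<le> r" using assms by auto
  have "card ?C = card ?U - card ?B" by (simp add: card_Diff_subset_Int Int_commute)
  then have cC: "card ?C = n - 2 * r + x" using cB xr assms(4) by simp
  show ?thesis
  proof (cases "z \<le> r")
    case False
    have "card (A \<inter> R) \<le> r" for R using fA assms(2) by (metis card_mono inf_le1)
    then have none: "{R \<in> r_subsets n r. card (A \<inter> R) = z} = {}" using False by auto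
    show ?thesis unfolding none using False by (simp add: binomial_eq_0)
  next
    case True
    let ?P = "{S. S \<subseteq> ?B \<and> card S = z} \<times> {S. S \<subseteq> ?C \<and> card S = r - z}"
    have "bij_betw (\<lambda>R. (A \<inter> R, R - A)) {R \<in> r_subsets n r. card (A \<inter> R) = z} ?P"
    proof (rule bij_betwI[where g = "\<lambda>(S, T). S \<union> T"])
      show "(\<lambda>R. (A \<inter> R, R - A)) \<in> {R \<in> r_subsets n r. card (A \<inter> R) = z} \<rightarrow> ?P"
      proof
        fix R assume R: "R \<in> {R \<in> r_subsets n r. card (A \<inter> R) = z}"
        then have RU: "R \<subseteq> ?U" "card R = r" "card (A \<inter> R) = z" by (auto simp: r_subsets_def)
        then have "finite R" using finite_subset by blast
        then have "card (R - A) = r - z"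
          using RU by (simp add: card_Diff_subset_Int Int_commute)
        then show "(A \<inter> R, R - A) \<in> ?P" using RU by auto
      qed
      show "(\<lambda>(S, T). S \<union> T) \<in> ?P \<rightarrow> {R \<in> r_subsets n r. card (A \<inter> R) = z}"
      proof
        fix p assume "p \<in> ?P"
        then obtain S T where p: "p = (S, T)" "S \<subseteq> ?B" "card S = z" "T \<subseteq> ?C" "card T = r - z"
          by auto
        have "finite S" "finite T" using p fA by (auto intro: finite_subset)
        moreover have "S \<inter> T = {}" "A \<inter> (S \<union> T) = S" using p by auto
        ultimately show "(\<lambda>(S, T). S \<union> T) p \<in> {R \<in> r_subsets n r. card (A \<inter> R) = z}"
          using p True by (auto simp: r_subsets_def card_Un_disjoint)
      qed
    qed auto
    then have "card {R \<in> r_subsets n r. card (A \<inter> R) = z} = card ?P" by (rule bij_betw_same_card)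
    also have "\<dots> = ((r - x) choose z) * ((n - 2 * r + x) choose (r - z))"
      using n_subsets[of ?B z] n_subsets[of ?C "r - z"] cB cC by (simp add: card_cartesian_product fA)
    finally show ?thesis .
  qed
qed

lemma pmf_type_shuffle_step:
  assumes "2 * r < n" "g permutes {1..n}"
  shows "pmf (map_pmf (perm_type r) (shuffle_step n r g)) z =
    real ((r - perm_type r g) choose z) * real ((n - 2 * r + perm_type r g) choose (r - z))
      / real ((n - r) choose r)"
proof -
  let ?A = "g ` {1..r}"
  have A: "?A \<subseteq> {1..n}" "card ?A = r"
    using assms permutes_image[OF assms(2)] permutes_inj[OF assms(2)]
    by (auto simp: card_image inj_on_def inj_def)
  have ne: "r_subsets n r \<noteq> {}"
    using card_r_subsets[of n r] assms(1) zero_less_binomial[of r "n - r"] by auto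
  have pt: "perm_type r (rank_perm n r R \<circ> g) = card (?A \<inter> R)" if "R \<in> r_subsets n r" for R
  proof -
    have top: "maps_to_top n r R (rank_perm n r R)" "R \<subseteq> {1..n}"
      using that maps_to_top_rank_perm r_subsets_sub by blast+
    then have "inj (rank_perm n r R)" unfolding maps_to_top_def using permutes_inj by blast
    moreover have "(rank_perm n r R \<circ> g) ` {1..r} \<inter> {1..r} = rank_perm n r R ` (?A \<inter> R)"
      using maps_to_top_vimage[OF top] unfolding image_comp[symmetric] by blast
    ultimately show ?thesis unfolding perm_type_def by (metis card_image inj_on_subset subset_UNIV)
  qed
  have "map_pmf (perm_type r) (shuffle_step n r g)
      = map_pmf (\<lambda>R. perm_type r (rank_perm n r R \<circ> g)) (pmf_of_set (r_subsets n r))"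
    unfolding shuffle_step_def skewed_perms_eq
    by (simp add: map_pmf_of_set_inj[OF inj_on_rank_perm ne finite_r_subsets, symmetric]
        map_pmf_comp)
  also have "\<dots> = map_pmf (\<lambda>R. card (?A \<inter> R)) (pmf_of_set (r_subsets n r))"
    using pt ne finite_r_subsets by (intro map_pmf_cong) auto
  also have "pmf \<dots> z = real (card (r_subsets n r \<inter> (\<lambda>R. card (?A \<inter> R)) -` {z}))
      / real (card (r_subsets n r))"
    using ne finite_r_subsets by (simp add: pmf_map measure_pmf_of_set)
  also have "r_subsets n r \<inter> (\<lambda>R. card (?A \<inter> R)) -` {z}
      = {R \<in> r_subsets n r. card (?A \<inter> R) = z}" by auto
  also have "card \<dots> = ((r - perm_type r g) choose z) * ((n - 2 * r + perm_type r g) choose (r - z))"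
    using card_inter_count[OF A _ assms(1)] unfolding perm_type_def by blast
  finally show ?thesis by (simp add: card_r_subsets)
qed

theorem shuffle_induces_type_step:
  assumes "2 * r < n" "g permutes {1..n}"
  shows "map_pmf (perm_type r) (shuffle_step n r g) = type_step n r (perm_type r g)"
proof -
  let ?G = "{h. h permutes {1..n} \<and> perm_type r h = perm_type r g}"
  have fin: "finite ?G" using finite_permutations[of "{1..n}"] by (auto intro: finite_subset)
  have ne: "?G \<noteq> {}" using assms(2) by blast
  have "map_pmf (perm_type r) (shuffle_step n r h) = map_pmf (perm_type r) (shuffle_step n r g)"
    if "h \<in> ?G" for h
    using that pmf_type_shuffle_step[OF assms(1)] assms(2) by (intro pmf_eqI) auto
  then have "bind_pmf (pmf_of_set ?G) (\<lambda>h. map_pmf (perm_type r) (shuffle_step n r h))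
     = bind_pmf (pmf_of_set ?G) (\<lambda>h. map_pmf (perm_type r) (shuffle_step n r g))"
    using fin ne by (intro bind_pmf_cong) auto
  then show ?thesis by (simp add: type_step_def map_bind_pmf bind_pmf_const)
qed

lemma exists_perm_of_type:
  assumes "2 * r < n" "x \<le> r"
  obtains g where "g permutes {1..n}" "perm_type r g = x"
proof -
  let ?A = "{1..x} \<union> {r+1..2*r-x}"
  have A: "?A \<subseteq> {1..n}" using assms by auto
  have "card ?A = card {1..x} + card {r+1..2*r-x}" using assms by (intro card_Un_disjoint) auto
  then have cA: "card ?A = r" using assms by simp
  let ?d = "rank_perm n r ?A"
  have d: "?d permutes {1..n}" "?d ` ?A = {1..r}"
    using maps_to_top_rank_perm[OF A cA] unfolding maps_to_top_def by auto
  have "inv_into UNIV ?d ` {1..r} = ?A"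
    using d(2) permutes_inj[OF d(1)] by (metis image_inv_f_f)
  moreover have "?A \<inter> {1..r} = {1..x}" using assms by auto
  ultimately have "perm_type r (inv_into UNIV ?d) = x" unfolding perm_type_def by simp
  then show thesis using that permutes_inv[OF d(1)] by blast
qed

theorem type_matrix_entry:
  assumes "2 * r < n" "x \<le> r" "z \<le> r"
  shows "type_matrix n r $$ (x, z) =
    real ((r - x) choose z) * real ((n - 2 * r + x) choose (r - z)) / real ((n - r) choose r)"
proof -
  obtain g where "g permutes {1..n}" "perm_type r g = x" using exists_perm_of_type assms by blast
  then show ?thesis
    using shuffle_induces_type_step[OF assms(1)] pmf_type_shuffle_step[OF assms(1)] assms
    by (metis (no_types, lifting) type_matrix_def index_mat(1) Suc_eq_plus1 less_Suc_eq_le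
        old.prod.case)
qed

end

theory Submission
  imports Defs
begin

text \<open>
  By Vandermonde's identity, a step from \<open>x\<close> sends the function \<open>z \<mapsto> z choose k\<close> to a multiple of
  \<open>x \<mapsto> (r - x) choose k\<close>, a polynomial of degree \<open>k\<close> in \<open>x\<close>.  In the basis of binomial
  coefficients the transition matrix is therefore upper triangular, and its diagonal entries
  have strictly decreasing absolute values, so it has \<open>r + 1\<close> distinct real eigenvalues.
  The chain is reversible with respect to the hypergeometric distribution; hence left eigenvectors
  are orthogonal for the inner product weighted by \<open>1 / \<pi>\<close>, and normalised ones form an
  orthonormal basis.  The first identity is Parseval's identity in this basis, and the bound on
  the total variation distance follows by Cauchy-Schwarz and \<open>\<pi> \<le> 1\<close>.
\<close>

subsection \<open>Expansions in a weighted orthonormal basis\<close>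

text \<open>The \<open>e i\<close> are the rows of a square matrix whose product with its transpose
  is 1; a one-sided inverse of a square matrix is two-sided, and the reversed product concerns the
  columns.\<close>

lemma orthonormal_rows_imp_columns:
  fixes e :: "nat \<Rightarrow> nat \<Rightarrow> real"
  assumes "\<And>i j. i < m \<Longrightarrow> j < m \<Longrightarrow> (\<Sum>x<m. e i x * e j x) = (if i = j then 1 else 0)"
    and "x < m" "y < m"
  shows "(\<Sum>i<m. e i x * e i y) = (if x = y then 1 else 0)"
proof -
  let ?A = "Matrix.mat m m (\<lambda>(i, x). e i x)"
  have "?A * transpose_mat ?A = 1\<^sub>m m"
    by (rule eq_matI) (auto simp: scalar_prod_def assms(1) atLeast0LessThan)
  then have "transpose_mat ?A * ?A = 1\<^sub>m m"
    by (rule mat_mult_left_right_inverse[rotated 2]) auto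
  then have "(transpose_mat ?A * ?A) $$ (x, y) = (if x = y then 1 else 0)"
    using assms(2,3) by simp
  then show ?thesis
    using assms(2,3) by (simp add: scalar_prod_def atLeast0LessThan)
qed

lemma weighted_inner_commute: "weighted_inner p u v = weighted_inner p v u"
  by (simp add: weighted_inner_def mult.commute)

lemma weighted_inner_smult_left:
  assumes "dim_vec u = dim_vec p"
  shows "weighted_inner p (a \<cdot>\<^sub>v u) v = a * weighted_inner p u v"
  using assms by (simp add: weighted_inner_def sum_distrib_left mult.assoc)

lemma weighted_inner_minus_left:
  assumes "dim_vec u = dim_vec p" "dim_vec v = dim_vec p"
  shows "weighted_inner p (u - v) w = weighted_inner p u w - weighted_inner p v w"
  using assms by (simp add: weighted_inner_def sum_subtractf[symmetric] left_diff_distrib diff_divide_distrib)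

lemma weighted_inner_sum_left:
  assumes "\<And>x. x < dim_vec p \<Longrightarrow> vec_index u x = (\<Sum>s\<in>S. a s * vec_index (\<psi> s) x)"
  shows "weighted_inner p u v = (\<Sum>s\<in>S. a s * weighted_inner p (\<psi> s) v)"
proof -
  have "weighted_inner p u v
      = (\<Sum>x<dim_vec p. \<Sum>s\<in>S. a s * (vec_index (\<psi> s) x * vec_index v x / vec_index p x))"
    unfolding weighted_inner_def using assms
    by (intro sum.cong refl) (simp add: sum_distrib_right sum_divide_distrib mult.assoc)
  also have "\<dots> = (\<Sum>s\<in>S. a s * weighted_inner p (\<psi> s) v)"
    unfolding weighted_inner_def sum_distrib_left by (rule sum.swap)
  finally show ?thesis .
qed

lemma weighted_inner_right_weight:
  assumes "\<And>x. x < dim_vec p \<Longrightarrow> vec_index p x > 0"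
  shows "weighted_inner p u p = (\<Sum>x<dim_vec p. vec_index u x)"
  unfolding weighted_inner_def
  by (intro sum.cong refl) (use assms in \<open>simp add: less_imp_neq[symmetric]\<close>)

text \<open>Dividing by \<open>sqrt (vec_index p x)\<close> turns the weighted inner product into
  the standard one, so the \<open>\<psi> s\<close> become the rows of an orthogonal matrix, square
  because \<open>card S = dim_vec p\<close>. Orthonormality of its columns is completeness of the
  basis.\<close>

lemma weighted_orthonormal_expansion:
  assumes pos: "\<And>x. x < dim_vec p \<Longrightarrow> vec_index p x > 0"
    and S: "finite S" "card S = dim_vec p"
    and ortho: "\<And>s t. s \<in> S \<Longrightarrow> t \<in> S \<Longrightarrow>
                  weighted_inner p (\<psi> s) (\<psi> t) = (if s = t then 1 else 0)"
    and x: "x < dim_vec p"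
  shows "vec_index u x = (\<Sum>s\<in>S. weighted_inner p u (\<psi> s) * vec_index (\<psi> s) x)"
proof -
  let ?m = "dim_vec p"
  obtain h where h: "bij_betw h {..<?m} S"
    using ex_bij_betw_nat_finite[OF S(1)] S(2) by (auto simp: atLeast0LessThan)
  define e where "e i y = vec_index (\<psi> (h i)) y / sqrt (vec_index p y)" for i y
  have e_mult: "e i y * e j y = vec_index (\<psi> (h i)) y * vec_index (\<psi> (h j)) y / vec_index p y"
    if "y < ?m" for i j y
    using pos[OF that] by (simp add: e_def)
  have "(\<Sum>y<?m. e i y * e j y) = (if i = j then 1 else 0)" if "i < ?m" "j < ?m" for i j
  proof -
    have "(\<Sum>y<?m. e i y * e j y) = weighted_inner p (\<psi> (h i)) (\<psi> (h j))"
      unfolding weighted_inner_def by (intro sum.cong) (auto simp: e_mult)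
    also have "\<dots> = (if h i = h j then 1 else 0)"
      using that bij_betwE[OF h] by (intro ortho) auto
    finally show ?thesis
      using that inj_onD[OF bij_betw_imp_inj_on[OF h]] by auto
  qed
  then have cols: "(\<Sum>i<?m. e i y * e i x) = (if y = x then 1 else 0)" if "y < ?m" for y
    using that x by (rule orthonormal_rows_imp_columns)
  have "(\<Sum>s\<in>S. weighted_inner p u (\<psi> s) * vec_index (\<psi> s) x)
      = (\<Sum>i<?m. weighted_inner p u (\<psi> (h i)) * vec_index (\<psi> (h i)) x)"
    by (rule sum.reindex_bij_betw[OF h, symmetric])
  \<comment> \<open>The quotient of square roots corrects the weights contained in
    \<open>e i y * e i x\<close>. After the sums are swapped, \<open>cols\<close> leaves only
    \<open>y = x\<close>, where the quotient is 1.\<close>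
  also have "\<dots> = (\<Sum>i<?m. \<Sum>y<?m. vec_index u y * sqrt (vec_index p x) / sqrt (vec_index p y)
                      * (e i y * e i x))"
    unfolding weighted_inner_def sum_distrib_right
  proof (intro sum.cong refl)
    fix i y assume "y \<in> {..<?m}"
    then have "vec_index p y > 0" "vec_index p x > 0" using pos x by auto
    then have "sqrt (vec_index p y) * sqrt (vec_index p y) = vec_index p y"
      "sqrt (vec_index p y) \<noteq> 0" "sqrt (vec_index p x) \<noteq> 0" "vec_index p y \<noteq> 0" by auto
    then show "vec_index u y * vec_index (\<psi> (h i)) y / vec_index p y * vec_index (\<psi> (h i)) x
        = vec_index u y * sqrt (vec_index p x) / sqrt (vec_index p y) * (e i y * e i x)"
      unfolding e_def by (simp add: field_simps)
  qed
  also have "\<dots> = (\<Sum>y<?m. vec_index u y * sqrt (vec_index p x) / sqrt (vec_index p y)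
                      * (\<Sum>i<?m. e i y * e i x))"
    unfolding sum_distrib_left by (rule sum.swap)
  also have "\<dots> = (\<Sum>y<?m. if y = x then vec_index u y * sqrt (vec_index p x) / sqrt (vec_index p y) else 0)"
    by (intro sum.cong) (auto simp: cols)
  also have "\<dots> = vec_index u x" using x pos[OF x] by simp
  finally show ?thesis by simp
qed

text \<open>It suffices to expand the left argument: each basis vector then pairs with
  \<open>u\<close> to give its own coefficient once more.\<close>

lemma weighted_parseval:
  assumes "\<And>x. x < dim_vec p \<Longrightarrow> vec_index p x > 0"
    and "finite S" "card S = dim_vec p"
    and "\<And>s t. s \<in> S \<Longrightarrow> t \<in> S \<Longrightarrow>
           weighted_inner p (\<psi> s) (\<psi> t) = (if s = t then 1 else 0)"
  shows "weighted_inner p u u = (\<Sum>s\<in>S. (weighted_inner p u (\<psi> s))\<^sup>2)"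
  unfolding power2_eq_square
  by (subst weighted_inner_sum_left[OF weighted_orthonormal_expansion[OF assms]])
     (auto simp: weighted_inner_commute)

lemma weighted_inner_self_pos:
  assumes "\<And>x. x < dim_vec p \<Longrightarrow> vec_index p x > 0"
    and "v \<in> carrier_vec (dim_vec p)" "v \<noteq> 0\<^sub>v (dim_vec p)"
  shows "weighted_inner p v v > 0"
proof -
  obtain x where x: "x < dim_vec p" "vec_index v x \<noteq> 0" using assms(2,3) by (metis carrier_vecD eq_vecI index_zero_vec)
  have "0 < vec_index v x * vec_index v x / vec_index p x"
    using x assms(1) by (metis divide_pos_pos not_real_square_gt_zero)
  also have "\<dots> \<le> weighted_inner p v v"
    unfolding weighted_inner_def using x(1) less_imp_le[OF assms(1)]
    by (intro member_le_sum) auto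
  finally show ?thesis .
qed

text \<open>Cauchy-Schwarz against the constant 1 costs the factor
  \<open>sqrt (real (dim_vec p))\<close>; dividing a square by a weight in (0, 1] does not decrease
  it.\<close>

lemma tv_dist_le_weighted_norm:
  assumes dim: "dim_vec q = dim_vec p"
    and p: "\<And>x. x < dim_vec p \<Longrightarrow> 0 < vec_index p x \<and> vec_index p x \<le> 1"
  shows "tv_dist q p \<le> sqrt (real (dim_vec p)) / 2 * sqrt (weighted_inner p (q - p) (q - p))"
proof -
  let ?d = "\<lambda>x. vec_index q x - vec_index p x"
  have "(\<Sum>x<dim_vec p. \<bar>?d x\<bar>) \<le> sqrt (real (dim_vec p) * (\<Sum>x<dim_vec p. (?d x)\<^sup>2))"
    using Cauchy_Schwarz_ineq_sum[of "\<lambda>x. \<bar>?d x\<bar>" "\<lambda>_. 1" "{..<dim_vec p}"]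
    by (intro real_le_rsqrt) (simp add: mult.commute)
  also have "(\<Sum>x<dim_vec p. (?d x)\<^sup>2) \<le> weighted_inner p (q - p) (q - p)"
    unfolding weighted_inner_def
  proof (rule sum_mono)
    fix x assume "x \<in> {..<dim_vec p}"
    then have x: "x < dim_vec p" by simp
    have "(?d x)\<^sup>2 * vec_index p x \<le> (?d x)\<^sup>2 * 1" using p[OF x] by (intro mult_left_mono) auto
    then have "(?d x)\<^sup>2 \<le> (?d x)\<^sup>2 / vec_index p x" using p[OF x] by (simp add: field_simps)
    then show "(?d x)\<^sup>2 \<le> vec_index (q - p) x * vec_index (q - p) x / vec_index p x"
      using x by (simp add: power2_eq_square)
  qed
  finally show ?thesis
    unfolding tv_dist_def dim by (simp add: real_sqrt_mult mult_left_mono)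
qed


subsection \<open>Reversible chains\<close>

lemma transpose_mult_index:
  fixes Q :: "real mat"
  assumes "Q \<in> carrier_mat m m" "v \<in> carrier_vec m" "z < m"
  shows "vec_index (transpose_mat Q *\<^sub>v v) z = (\<Sum>x<m. vec_index v x * Q $$ (x, z))"
  using assms by (simp add: scalar_prod_def atLeast0LessThan mult.commute[of "vec_index v _"])

text \<open>By detailed balance \<open>Q $$ (x, z) / vec_index p z\<close> is symmetric in
  \<open>x\<close> and \<open>z\<close>; after this exchange, swapping the sums moves the matrix to
  the other argument.\<close>

lemma weighted_inner_transpose_adjoint:
  assumes Q: "Q \<in> carrier_mat (dim_vec p) (dim_vec p)"
    and pos: "\<And>x. x < dim_vec p \<Longrightarrow> vec_index p x > 0"
    and rev: "\<And>x z. x < dim_vec p \<Longrightarrow> z < dim_vec p \<Longrightarrow>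
                vec_index p x * Q $$ (x, z) = vec_index p z * Q $$ (z, x)"
    and u: "u \<in> carrier_vec (dim_vec p)" and v: "v \<in> carrier_vec (dim_vec p)"
  shows "weighted_inner p (transpose_mat Q *\<^sub>v u) v = weighted_inner p u (transpose_mat Q *\<^sub>v v)"
proof -
  let ?m = "dim_vec p"
  have ent: "vec_index (transpose_mat Q *\<^sub>v w) z = (\<Sum>x<?m. Q $$ (x, z) * vec_index w x)"
    if "w \<in> carrier_vec ?m" "z < ?m" for w z
    using transpose_mult_index[OF Q that] by (simp add: mult.commute)
  have "weighted_inner p (transpose_mat Q *\<^sub>v u) v
      = (\<Sum>z<?m. \<Sum>x<?m. Q $$ (x, z) * vec_index u x * vec_index v z / vec_index p z)"
    unfolding weighted_inner_def using u
    by (intro sum.cong refl) (simp add: ent sum_distrib_right sum_divide_distrib del: index_mult_mat_vec)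
  also have "\<dots> = (\<Sum>z<?m. \<Sum>x<?m. Q $$ (z, x) * vec_index u x * vec_index v z / vec_index p x)"
  proof (intro sum.cong refl)
    fix x z assume "x \<in> {..<?m}" "z \<in> {..<?m}"
    then have "Q $$ (x, z) / vec_index p z = Q $$ (z, x) / vec_index p x"
      using pos[of x] pos[of z] rev[of x z] by (simp add: field_simps)
    then show "Q $$ (x, z) * vec_index u x * vec_index v z / vec_index p z
        = Q $$ (z, x) * vec_index u x * vec_index v z / vec_index p x"
      by (metis (no_types, lifting) times_divide_eq_left)
  qed
  also have "\<dots> = (\<Sum>x<?m. \<Sum>z<?m. Q $$ (z, x) * vec_index u x * vec_index v z / vec_index p x)"
    by (rule sum.swap)
  also have "\<dots> = weighted_inner p u (transpose_mat Q *\<^sub>v v)"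
    unfolding weighted_inner_def using v
    by (intro sum.cong refl)
       (simp add: ent sum_distrib_left sum_divide_distrib mult_ac del: index_mult_mat_vec)
  finally show ?thesis .
qed

lemma eigenvectors_weighted_orthogonal:
  assumes "Q \<in> carrier_mat (dim_vec p) (dim_vec p)"
    and "\<And>x. x < dim_vec p \<Longrightarrow> vec_index p x > 0"
    and "\<And>x z. x < dim_vec p \<Longrightarrow> z < dim_vec p \<Longrightarrow>
           vec_index p x * Q $$ (x, z) = vec_index p z * Q $$ (z, x)"
    and u: "u \<in> carrier_vec (dim_vec p)" "transpose_mat Q *\<^sub>v u = a \<cdot>\<^sub>v u"
    and v: "v \<in> carrier_vec (dim_vec p)" "transpose_mat Q *\<^sub>v v = b \<cdot>\<^sub>v v"
    and "a \<noteq> b"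
  shows "weighted_inner p u v = 0"
proof -
  have "a * weighted_inner p u v = b * weighted_inner p u v"
    using weighted_inner_transpose_adjoint[OF assms(1-3) u(1) v(1)] u v
    by (metis carrier_vecD weighted_inner_commute weighted_inner_smult_left)
  then show ?thesis using \<open>a \<noteq> b\<close> by simp
qed

text \<open>Meant for the law of a chain, which is known through its recursion. Each time step moves
  \<open>Q\<close> onto the eigenvector and releases a factor \<open>a\<close>.\<close>

lemma weighted_inner_transpose_pow:
  assumes "Q \<in> carrier_mat (dim_vec p) (dim_vec p)"
    and "\<And>x. x < dim_vec p \<Longrightarrow> vec_index p x > 0"
    and "\<And>x z. x < dim_vec p \<Longrightarrow> z < dim_vec p \<Longrightarrow>
           vec_index p x * Q $$ (x, z) = vec_index p z * Q $$ (z, x)"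
    and v: "v \<in> carrier_vec (dim_vec p)" "transpose_mat Q *\<^sub>v v = a \<cdot>\<^sub>v v"
    and f: "\<And>t. f t \<in> carrier_vec (dim_vec p)" "\<And>t. f (Suc t) = transpose_mat Q *\<^sub>v f t"
  shows "weighted_inner p (f t) v = a ^ t * weighted_inner p (f 0) v"
proof (induction t)
  case (Suc t)
  have "weighted_inner p (f (Suc t)) v = weighted_inner p (f t) (a \<cdot>\<^sub>v v)"
    using weighted_inner_transpose_adjoint[OF assms(1-3) f(1) v(1)] f(2) v(2) by simp
  also have "\<dots> = a * weighted_inner p (f t) v"
    using v(1) by (metis carrier_vecD weighted_inner_commute weighted_inner_smult_left)
  finally show ?case using Suc.IH by simp
qed simp

text \<open>\<open>spectrum\<close> refers to right eigenvectors; left ones exist because a matrix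
  and its transpose have the same characteristic polynomial.\<close>

lemma exists_normalized_left_eigenvector:
  fixes Q :: "real mat"
  assumes "Q \<in> carrier_mat (dim_vec p) (dim_vec p)"
    and pos: "\<And>x. x < dim_vec p \<Longrightarrow> vec_index p x > 0"
    and "\<mu> \<in> spectrum Q"
  shows "\<exists>v. v \<in> carrier_vec (dim_vec p) \<and> transpose_mat Q *\<^sub>v v = \<mu> \<cdot>\<^sub>v v \<and> weighted_inner p v v = 1"
proof -
  let ?m = "dim_vec p"
  have QT: "transpose_mat Q \<in> carrier_mat ?m ?m" using assms(1) by simp
  have "poly (char_poly (transpose_mat Q)) \<mu> = 0"
    using assms(3) unfolding spectrum_root_char_poly[OF assms(1)] by (simp add: char_poly_transpose_mat[OF assms(1)])
  then have "eigenvalue (transpose_mat Q) \<mu>" by (simp add: eigenvalue_root_char_poly[OF QT])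
  then obtain v where v: "v \<in> carrier_vec ?m" "v \<noteq> 0\<^sub>v ?m" "transpose_mat Q *\<^sub>v v = \<mu> \<cdot>\<^sub>v v"
    using assms(1) unfolding eigenvalue_def eigenvector_def by auto
  define a where "a = 1 / sqrt (weighted_inner p v v)"
  have "weighted_inner p v v > 0" by (rule weighted_inner_self_pos[OF pos v(1,2)])
  then have "a * (a * weighted_inner p v v) = 1" by (simp add: a_def field_simps)
  moreover have "weighted_inner p (a \<cdot>\<^sub>v v) (a \<cdot>\<^sub>v v) = a * (a * weighted_inner p v v)"
    using v(1) by (metis carrier_vecD index_smult_vec(2) weighted_inner_commute weighted_inner_smult_left)
  moreover have "transpose_mat Q *\<^sub>v (a \<cdot>\<^sub>v v) = \<mu> \<cdot>\<^sub>v (a \<cdot>\<^sub>v v)"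
    using v QT by (simp add: mult_mat_vec smult_smult_assoc mult.commute)
  ultimately show ?thesis using v(1) by (metis smult_carrier_vec)
qed


subsection \<open>One-step evolution of the law of a Markov chain\<close>

lemma markov_chain_two_step:
  fixes M :: "nat \<Rightarrow> 'w \<Rightarrow> 's :: countable"
  assumes "markov_chain \<Omega> M K"
  shows "\<P>(\<omega> in \<Omega>. M t \<omega> = x \<and> M (Suc t) \<omega> = z) = \<P>(\<omega> in \<Omega>. M t \<omega> = x) * pmf (K x) z"
proof -
  have ps: "prob_space \<Omega>" and [measurable]: "\<And>t. M t \<in> measurable \<Omega> (count_space UNIV)"
    and step: "\<And>t s. \<P>(\<omega> in \<Omega>. \<forall>i\<le>Suc t. M i \<omega> = s i)
            = \<P>(\<omega> in \<Omega>. \<forall>i\<le>t. M i \<omega> = s i) * pmf (K (s t)) (s (Suc t))"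
    using assms unfolding markov_chain_def by auto
  interpret prob_space \<Omega> by (rule ps)
  \<comment> \<open>\<open>markov_chain\<close> only speaks of complete histories, so sum over the histories before time \<open>t\<close>.\<close>
  define I where "I = {l :: 's list. length l = t}"
  \<comment> \<open>\<open>l\<close> covers times 0 to \<open>t - 1\<close>, so the appended
    \<open>x\<close> and \<open>z\<close> sit exactly at times \<open>t\<close> and
    \<open>Suc t\<close>.\<close>
  define s where "s l = (\<lambda>i. (l @ [x, z]) ! i)" for l
  define X where "X l = {\<omega> \<in> space \<Omega>. \<forall>i\<le>Suc t. M i \<omega> = s l i}" for l
  define Y where "Y l = {\<omega> \<in> space \<Omega>. \<forall>i\<le>t. M i \<omega> = s l i}" for l
  have sets: "X l \<in> sets \<Omega>" "Y l \<in> sets \<Omega>" for l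
    unfolding X_def Y_def by measurable
  have cI: "countable I" by (rule countable_subset[of _ UNIV]) auto
  have s_eq: "s l t = x" "s l (Suc t) = z" "\<And>i. i < t \<Longrightarrow> s l i = l ! i" if "l \<in> I" for l
    using that by (auto simp: s_def I_def nth_append)
  have hist: "l = map (\<lambda>i. M i \<omega>) [0..<t]" if "l \<in> I" "\<omega> \<in> Y l" for l \<omega>
    using that s_eq(3)[OF that(1)] by (intro nth_equalityI) (auto simp: I_def Y_def)
  have disjY: "disjoint_family_on Y I"
    unfolding disjoint_family_on_def using hist by blast
  have XY: "X l \<subseteq> Y l" for l unfolding X_def Y_def by auto
  have disjX: "disjoint_family_on X I"
    using disjY XY unfolding disjoint_family_on_def by blast
  have UY: "\<Union> (Y ` I) = {\<omega> \<in> space \<Omega>. M t \<omega> = x}"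
  proof (intro equalityI subsetI)
    fix \<omega> assume w: "\<omega> \<in> {\<omega> \<in> space \<Omega>. M t \<omega> = x}"
    let ?l = "map (\<lambda>i. M i \<omega>) [0..<t]"
    have "?l \<in> I" by (simp add: I_def)
    moreover have "\<omega> \<in> Y ?l" using w s_eq[OF \<open>?l \<in> I\<close>] by (auto simp: Y_def le_less)
    ultimately show "\<omega> \<in> \<Union> (Y ` I)" by blast
  qed (use s_eq in \<open>auto simp: Y_def\<close>)
  have UX: "\<Union> (X ` I) = {\<omega> \<in> space \<Omega>. M t \<omega> = x \<and> M (Suc t) \<omega> = z}"
  proof -
    have "X l = Y l \<inter> {\<omega> \<in> space \<Omega>. M (Suc t) \<omega> = z}" if "l \<in> I" for l
      using s_eq[OF that] by (auto simp: X_def Y_def le_Suc_eq)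
    then have "\<Union> (X ` I) = \<Union> (Y ` I) \<inter> {\<omega> \<in> space \<Omega>. M (Suc t) \<omega> = z}" by blast
    then show ?thesis unfolding UY by blast
  qed
  have eq: "emeasure \<Omega> (X l) = emeasure \<Omega> (Y l) * ennreal (pmf (K x) z)" if "l \<in> I" for l
    using step[of t "s l"] s_eq[OF that] unfolding X_def Y_def
    by (simp add: emeasure_eq_measure ennreal_mult)
  have "emeasure \<Omega> (\<Union> (X ` I)) = (\<integral>\<^sup>+l. emeasure \<Omega> (X l) \<partial>count_space I)"
    using sets cI disjX by (intro emeasure_UN_countable) auto
  also have "\<dots> = (\<integral>\<^sup>+l. emeasure \<Omega> (Y l) * ennreal (pmf (K x) z) \<partial>count_space I)"
    by (intro nn_integral_cong) (simp add: eq)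
  also have "\<dots> = (\<integral>\<^sup>+l. emeasure \<Omega> (Y l) \<partial>count_space I) * ennreal (pmf (K x) z)"
    by (rule nn_integral_multc) auto
  also have "(\<integral>\<^sup>+l. emeasure \<Omega> (Y l) \<partial>count_space I) = emeasure \<Omega> (\<Union> (Y ` I))"
    using sets cI disjY by (intro emeasure_UN_countable[symmetric]) auto
  finally show ?thesis
    unfolding UX UY by (simp add: emeasure_eq_measure ennreal_mult[symmetric])
qed

text \<open>Vanishing point masses outside \<open>A\<close> put \<open>M t\<close> in
  \<open>A\<close> almost surely because the state type is countable; the event at the next time
  then splits into finitely many cases.\<close>

lemma markov_chain_law_Suc:
  fixes M :: "nat \<Rightarrow> 'w \<Rightarrow> 's :: countable"
  assumes "markov_chain \<Omega> M K" "finite A"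
    and null: "\<And>x. x \<notin> A \<Longrightarrow> \<P>(\<omega> in \<Omega>. M t \<omega> = x) = 0"
  shows "\<P>(\<omega> in \<Omega>. M (Suc t) \<omega> = z) = (\<Sum>x\<in>A. \<P>(\<omega> in \<Omega>. M t \<omega> = x) * pmf (K x) z)"
proof -
  have ps: "prob_space \<Omega>" and [measurable]: "\<And>t. M t \<in> measurable \<Omega> (count_space UNIV)"
    using assms(1) unfolding markov_chain_def by auto
  interpret prob_space \<Omega> by (rule ps)
  have "AE \<omega> in \<Omega>. M t \<omega> \<noteq> x" if "x \<notin> A" for x
    using null[OF that] by (subst (asm) prob_Collect_eq_0) auto
  then have "AE \<omega> in \<Omega>. \<forall>x\<in>-A. M t \<omega> \<noteq> x"
    by (intro AE_ball_countable[THEN iffD2]) auto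
  then have inA: "AE \<omega> in \<Omega>. M t \<omega> \<in> A" by eventually_elim blast
  let ?E = "\<lambda>x. {\<omega> \<in> space \<Omega>. M t \<omega> = x \<and> M (Suc t) \<omega> = z}"
  have "prob {\<omega> \<in> space \<Omega>. M (Suc t) \<omega> = z} = prob (\<Union>x\<in>A. ?E x)"
    using inA by (intro finite_measure_eq_AE) (auto intro: assms(2))
  also have "\<dots> = (\<Sum>x\<in>A. prob (?E x))"
    using assms(2) by (intro finite_measure_finite_Union) (auto simp: disjoint_family_on_def)
  finally show ?thesis using markov_chain_two_step[OF assms(1)] by simp
qed


subsection \<open>Binomial identities\<close>

text \<open>Choosing \<open>z\<close> of \<open>a\<close> objects and then \<open>k\<close> of those
  amounts to choosing the \<open>k\<close> first and then \<open>z - k\<close> of the other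
  \<open>a - k\<close>. The factor \<open>a choose k\<close> leaves the sum, and Vandermonde's
  identity remains. Up to normalisation these are the binomial moments of a row of the transition
  matrix.\<close>

lemma vandermonde_factorial_moment:
  fixes a b k r :: nat
  assumes "k \<le> r"
  shows "(\<Sum>z\<le>r. (a choose z) * (z choose k) * (b choose (r - z)))
           = (a choose k) * ((a + b - k) choose (r - k))"
proof (cases "k \<le> a")
  case False
  then have "(a choose z) * (z choose k) = 0" for z by (cases "z \<le> a") auto
  then show ?thesis using False by simp
next
  case True
  have ch: "(a choose z) * (z choose k) = (a choose k) * ((a - k) choose (z - k))" if "k \<le> z" for z
  proof (cases "z \<le> a")
    case True
    then show ?thesis using choose_mult[OF that True] by simp
  next
    case False
    then have "a choose z = 0" "((a - k) choose (z - k)) = 0"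
      using that True by (auto intro: binomial_eq_0)
    then show ?thesis by (simp only: mult_0 mult_0_right)
  qed
  have "(\<Sum>z\<le>r. (a choose z) * (z choose k) * (b choose (r - z)))
      = (\<Sum>z\<in>{k..r}. (a choose z) * (z choose k) * (b choose (r - z)))"
    by (rule sum.mono_neutral_right) auto
  also have "\<dots> = (\<Sum>i\<le>r - k. (a choose (i + k)) * ((i + k) choose k) * (b choose (r - (i + k))))"
    using sum.shift_bounds_cl_nat_ivl[of _ 0 k "r - k"] assms by (simp add: atLeast0AtMost)
  also have "\<dots> = (\<Sum>i\<le>r - k. (a choose k) * (((a - k) choose i) * (b choose (r - k - i))))"
    by (intro sum.cong refl) (simp add: ch add.commute mult.assoc)
  also have "\<dots> = (a choose k) * ((a - k + b) choose (r - k))"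
    by (simp only: sum_distrib_left[symmetric] vandermonde)
  finally show ?thesis using True by simp
qed

text \<open>Inclusion-exclusion for the \<open>k\<close>-subsets of an \<open>r\<close>-set that
  avoid a given \<open>x\<close>-subset, derived here from Pascal's rule. Only
  \<open>x choose j\<close> with \<open>j \<le> k\<close> occur, which will make the matrix
  triangular. For \<open>j > r\<close> the truncated differences are harmless, since then
  \<open>x choose j\<close> is 0.\<close>

lemma choose_diff_expansion:
  fixes x r k :: nat
  assumes "x \<le> r"
  shows "int ((r - x) choose k)
           = (\<Sum>j\<le>k. (-1) ^ j * int (x choose j) * int ((r - j) choose (k - j)))"
  using assms
proof (induction x arbitrary: r k)
  case 0
  have "(\<Sum>j\<le>k. (-1) ^ j * int (0 choose j) * int ((r - j) choose (k - j)))
      = (\<Sum>j\<in>{0}. (-1) ^ j * int (0 choose j) * int ((r - j) choose (k - j)))"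
    by (rule sum.mono_neutral_right) (auto simp: binomial_eq_0)
  then show ?case by simp
next
  case (Suc x)
  show ?case
  proof (cases k)
    case (Suc l)
    let ?f = "\<lambda>j. (-1) ^ j * int (Suc x choose j) * int ((r - j) choose (k - j))"
    let ?g = "\<lambda>j. (-1) ^ j * int (x choose j) * int ((r - j) choose (k - j))"
    let ?h = "\<lambda>j. (-1) ^ j * int (x choose j) * int ((r - 1 - j) choose (l - j))"
    have "(\<Sum>j\<le>k. ?f j) = ?f 0 + (\<Sum>j\<le>l. ?f (Suc j))"
      unfolding Suc by (rule sum.atMost_Suc_shift)
    \<comment> \<open>Pascal's rule on \<open>Suc x choose Suc j\<close>: the part
      \<open>x choose Suc j\<close> gives \<open>?g (Suc j)\<close>, and the part
      \<open>x choose j\<close> gives \<open>?h j\<close> with the opposite sign.\<close>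
    also have "(\<Sum>j\<le>l. ?f (Suc j)) = (\<Sum>j\<le>l. ?g (Suc j) - ?h j)"
      by (intro sum.cong) (auto simp: Suc algebra_simps)
    also have "?f 0 + \<dots> = (?g 0 + (\<Sum>j\<le>l. ?g (Suc j))) - (\<Sum>j\<le>l. ?h j)"
      by (simp add: sum_subtractf)
    also have "?g 0 + (\<Sum>j\<le>l. ?g (Suc j)) = (\<Sum>j\<le>k. ?g j)"
      unfolding Suc by (rule sum.atMost_Suc_shift[symmetric])
    also have "(\<Sum>j\<le>k. ?g j) - (\<Sum>j\<le>l. ?h j) = int ((r - x) choose k) - int ((r - 1 - x) choose l)"
      using Suc.IH[of r k] Suc.IH[of "r - 1" l] Suc.prems by simp
    also have "\<dots> = int ((r - Suc x) choose k)"
    proof -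
      have "r - x = Suc (r - Suc x)" using Suc.prems by simp
      then show ?thesis by (simp add: Suc)
    qed
    finally show ?thesis by simp
  qed simp
qed

text \<open>Both sides count ordered pairs of disjoint subsets of sizes \<open>b\<close> and
  \<open>c\<close> of an \<open>a\<close>-set; there are none if \<open>b + c > a\<close>.\<close>

lemma choose_mult_choose_diff_commute:
  fixes a b c :: nat
  shows "(a choose b) * ((a - b) choose c) = (a choose c) * ((a - c) choose b)"
proof (cases "b + c \<le> a")
  case True
  have "(a choose b) * ((a - b) choose c) = (a choose (b + c)) * ((b + c) choose b)"
    using choose_mult[of b "b + c" a] True by simp
  also have "\<dots> = (a choose (b + c)) * ((b + c) choose c)"
    using binomial_symmetric[of b "b + c"] by simp
  also have "\<dots> = (a choose c) * ((a - c) choose b)"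
    using choose_mult[of c "b + c" a] True by simp
  finally show ?thesis .
next
  case False
  then show ?thesis by (cases "b \<le> a"; cases "c \<le> a") (auto simp: binomial_eq_0)
qed

text \<open>By Pascal's rule consecutive values differ by a binomial coefficient, positive because
  \<open>r < m\<close>. This separates the eigenvalues by absolute value.\<close>

lemma choose_diff_diff_strict_decreasing:
  fixes m r j k :: nat
  assumes "r < m" "j < k" "k \<le> r"
  shows "((m - k) choose (r - k)) < ((m - j) choose (r - j))"
  using assms(2,3)
proof (induction rule: less_Suc_induct)
  case (1 i)
  have "m - i = Suc (m - Suc i)" "r - i = Suc (r - Suc i)" using 1 assms(1) by simp_all
  moreover have "((m - Suc i) choose (Suc (r - Suc i))) > 0"
    using 1 assms(1) by (intro zero_less_binomial) simp
  ultimately show ?case by simp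
next
  case (2 i j k)
  then show ?case by simp
qed


subsection \<open>The transition matrix on types\<close>

text \<open>The main theorem starts from an arbitrary invariant distribution; this explicit vector
  is identified with it in \<open>invariant_distribution_type_matrix\<close>.\<close>

definition hypergeometric_vec :: "nat \<Rightarrow> nat \<Rightarrow> real vec" where
  "hypergeometric_vec n r =
     Matrix.vec (r + 1) (\<lambda>x. real (r choose x) * real ((n - r) choose (r - x)) / real (n choose r))"

lemma dim_hypergeometric_vec [simp]: "dim_vec (hypergeometric_vec n r) = r + 1"
  by (simp add: hypergeometric_vec_def)

lemma hypergeometric_vec_pos:
  assumes "2 * r < n" "x < r + 1"
  shows "vec_index (hypergeometric_vec n r) x > 0"
  using assms by (simp add: hypergeometric_vec_def)

lemma prob_vec_hypergeometric_vec:
  assumes "2 * r < n"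
  shows "prob_vec (r + 1) (hypergeometric_vec n r)"
proof -
  have "(\<Sum>x<r + 1. vec_index (hypergeometric_vec n r) x)
      = real (\<Sum>x\<le>r. (r choose x) * ((n - r) choose (r - x))) / real (n choose r)"
    by (simp add: hypergeometric_vec_def sum_divide_distrib lessThan_Suc_atMost)
  also have "\<dots> = 1" using assms by (simp add: vandermonde)
  finally show ?thesis
    using hypergeometric_vec_pos[OF assms] less_imp_le
    unfolding prob_vec_def carrier_vec_def by auto
qed

lemma type_matrix_carrier: "type_matrix n r \<in> carrier_mat (r + 1) (r + 1)"
  by (simp add: type_matrix_def)

text \<open>Writing \<open>n - 2 * r + x\<close> as \<open>(n - r) - (r - x)\<close> exposes two
  instances of \<open>choose_mult_choose_diff_commute\<close>, one inside \<open>r\<close> and one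
  inside \<open>n - r\<close>; the denominators agree.\<close>

lemma type_matrix_detailed_balance:
  assumes "2 * r < n" "x < r + 1" "z < r + 1"
  shows "vec_index (hypergeometric_vec n r) x * type_matrix n r $$ (x, z)
           = vec_index (hypergeometric_vec n r) z * type_matrix n r $$ (z, x)"
proof -
  have "n - 2 * r + x = (n - r) - (r - x)" "n - 2 * r + z = (n - r) - (r - z)"
    using assms by simp_all
  then have "(r choose x) * ((n - r) choose (r - x)) * (((r - x) choose z) * ((n - 2 * r + x) choose (r - z)))
     = (r choose z) * ((n - r) choose (r - z)) * (((r - z) choose x) * ((n - 2 * r + z) choose (r - x)))"
    using choose_mult_choose_diff_commute[of r x z]
      choose_mult_choose_diff_commute[of "n - r" "r - x" "r - z"] by (metis mult.assoc mult.left_commute)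
  then have "real (r choose x) * real ((n - r) choose (r - x)) * (real ((r - x) choose z) * real ((n - 2 * r + x) choose (r - z)))
     = real (r choose z) * real ((n - r) choose (r - z)) * (real ((r - z) choose x) * real ((n - 2 * r + z) choose (r - x)))"
    by (simp only: of_nat_mult[symmetric] of_nat_eq_iff)
  then show ?thesis
    using assms by (simp add: hypergeometric_vec_def type_matrix_entry)
qed

text \<open>The bound comes from the outer map: \<open>perm_type\<close> never exceeds
  \<open>r\<close>, whatever the inner distribution is, so starting points \<open>x > r\<close> are
  covered too.\<close>

lemma pmf_type_step_eq_0:
  assumes "z > r"
  shows "pmf (type_step n r x) z = 0"
proof -
  have "perm_type r g \<le> r" for g
    unfolding perm_type_def using card_mono[of "{1..r}" "g ` {1..r} \<inter> {1..r}"] by simp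
  then have "set_pmf (type_step n r x) \<subseteq> {..r}" by (auto simp: type_step_def)
  then show ?thesis using assms by (metis atMost_iff not_le set_pmf_iff subsetD)
qed

lemma type_matrix_row_sum:
  assumes "x < r + 1"
  shows "(\<Sum>z<r + 1. type_matrix n r $$ (x, z)) = 1"
proof -
  have "set_pmf (type_step n r x) \<subseteq> {..<r + 1}"
    using pmf_type_step_eq_0[of r _ n x] by (auto simp: set_pmf_iff less_Suc_eq_le not_less[symmetric])
  then have "(\<Sum>z<r + 1. pmf (type_step n r x) z) = 1"
    by (intro sum_pmf_eq_1) auto
  then show ?thesis using assms by (simp add: type_matrix_def)
qed

lemma hypergeometric_vec_invariant:
  assumes "2 * r < n"
  shows "transpose_mat (type_matrix n r) *\<^sub>v hypergeometric_vec n r = hypergeometric_vec n r"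
proof (rule eq_vecI)
  fix z assume "z < dim_vec (hypergeometric_vec n r)"
  then have z: "z < r + 1" by simp
  have "vec_index (transpose_mat (type_matrix n r) *\<^sub>v hypergeometric_vec n r) z
      = (\<Sum>x<r + 1. vec_index (hypergeometric_vec n r) x * type_matrix n r $$ (x, z))"
    using z by (intro transpose_mult_index) (auto intro: carrier_vecI type_matrix_carrier[unfolded Suc_eq_plus1[symmetric]])
  also have "\<dots> = (\<Sum>x<r + 1. vec_index (hypergeometric_vec n r) z * type_matrix n r $$ (z, x))"
    using z by (intro sum.cong refl type_matrix_detailed_balance[OF assms]) auto
  also have "\<dots> = vec_index (hypergeometric_vec n r) z"
    using type_matrix_row_sum[OF z] by (simp add: sum_distrib_left[symmetric])
  finally show "vec_index (transpose_mat (type_matrix n r) *\<^sub>v hypergeometric_vec n r) z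
    = vec_index (hypergeometric_vec n r) z" .
qed (simp add: type_matrix_def)


subsection \<open>Simplicity of the spectrum\<close>

text \<open>A diagonal entry is a root of the characteristic polynomial of \<open>U\<close>. If
  \<open>v\<close> is a corresponding eigenvector, then \<open>P *\<^sub>v v\<close> is one of
  \<open>Q\<close>, nonzero because \<open>P\<close> is invertible.\<close>

lemma eigenvalue_of_intertwined_upper_triangular:
  fixes Q P U :: "real mat"
  assumes Q: "Q \<in> carrier_mat m m" and P: "P \<in> carrier_mat m m" and U: "U \<in> carrier_mat m m"
    and QP: "Q * P = P * U" and "Determinant.det P \<noteq> 0"
    and "upper_triangular U" "k < m"
  shows "eigenvalue Q (U $$ (k, k))"
proof -
  have "U $$ (k, k) \<in> set (diag_mat U)" using U \<open>k < m\<close> by (auto simp: diag_mat_def)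
  then have "poly (char_poly U) (U $$ (k, k)) = 0"
    unfolding char_poly_upper_triangular[OF U \<open>upper_triangular U\<close>]
    by (auto simp: poly_prod_list o_def prod_list_zero_iff)
  then have "eigenvalue U (U $$ (k, k))" by (simp add: eigenvalue_root_char_poly[OF U])
  then obtain v where v: "v \<in> carrier_vec m" "v \<noteq> 0\<^sub>v m" "U *\<^sub>v v = U $$ (k, k) \<cdot>\<^sub>v v"
    using U unfolding eigenvalue_def eigenvector_def by auto
  have "Q *\<^sub>v (P *\<^sub>v v) = P *\<^sub>v (U *\<^sub>v v)"
    using Q P U v(1) QP by (metis assoc_mult_mat_vec)
  also have "\<dots> = U $$ (k, k) \<cdot>\<^sub>v (P *\<^sub>v v)"
    using P v by (simp add: mult_mat_vec)
  finally have "Q *\<^sub>v (P *\<^sub>v v) = U $$ (k, k) \<cdot>\<^sub>v (P *\<^sub>v v)" .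
  moreover have "P *\<^sub>v v \<noteq> 0\<^sub>v m"
    using \<open>Determinant.det P \<noteq> 0\<close> v det_0_iff_vec_prod_zero[OF P] by blast
  ultimately show ?thesis
    using Q P v(1) unfolding eigenvalue_def eigenvector_def by (metis carrier_matD(1) mult_mat_vec_carrier)
qed

text \<open>The columns of \<open>?P\<close> are the functions \<open>z choose k\<close>, and
  \<open>?U\<close> is the action of the chain on them. The value equals
  \<open>(-1) ^ k * (r choose k) / ((n - r) choose k)\<close>; with a denominator free of
  \<open>k\<close>, absolute values are easy to compare.\<close>

lemma eigenvalue_type_matrix:
  assumes "2 * r < n" "k \<le> r"
  shows "eigenvalue (type_matrix n r)
           ((-1) ^ k * real ((n - r - k) choose (r - k)) / real ((n - r) choose r))"
proof -
  let ?m = "r + 1" and ?N = "real ((n - r) choose r)"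
  define c where "c k = real ((n - r - k) choose (r - k)) / ?N" for k
  let ?P = "Matrix.mat ?m ?m (\<lambda>(z, k). real (z choose k))"
  \<comment> \<open>The coefficients of \<open>choose_diff_expansion\<close> scaled by
    \<open>c k\<close>; for \<open>j = k\<close> the binomial coefficient is 1, which leaves
    \<open>(-1) ^ k * c k\<close> on the diagonal.\<close>
  let ?U = "Matrix.mat ?m ?m (\<lambda>(j, k). if j \<le> k then (-1) ^ j * real ((r - j) choose (k - j)) * c k else 0)"
  have QP: "type_matrix n r * ?P = ?P * ?U"
  proof (rule eq_matI)
    fix x k assume "x < dim_row (?P * ?U)" "k < dim_col (?P * ?U)"
    then have xk: "x \<le> r" "k \<le> r" by auto
    have "(type_matrix n r * ?P) $$ (x, k) = (\<Sum>z\<le>r. type_matrix n r $$ (x, z) * real (z choose k))"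
      using xk by (simp add: type_matrix_def scalar_prod_def atLeast0LessThan lessThan_Suc_atMost)
    also have "\<dots> = real (\<Sum>z\<le>r. ((r - x) choose z) * (z choose k) * ((n - 2 * r + x) choose (r - z))) / ?N"
      unfolding of_nat_sum sum_divide_distrib
      by (intro sum.cong refl) (simp add: type_matrix_entry[OF assms(1) xk(1)])
    \<comment> \<open>The upper indices \<open>r - x\<close> and \<open>n - 2 * r + x\<close> add up
      to \<open>n - r\<close> for every \<open>x\<close>, so the second factor of the moment depends
      on \<open>k\<close> only.\<close>
    also have "\<dots> = real ((r - x) choose k) * c k"
    proof -
      have "r - x + (n - 2 * r + x) - k = n - r - k" using xk assms by simp
      then show ?thesis unfolding vandermonde_factorial_moment[OF xk(2)] c_def by simp
    qed
    also have "\<dots> = real_of_int (int ((r - x) choose k)) * c k" by simp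
    also have "\<dots> = (\<Sum>j\<le>k. real (x choose j) * ((-1) ^ j * real ((r - j) choose (k - j)) * c k))"
      unfolding choose_diff_expansion[OF xk(1)] by (simp add: sum_distrib_left mult_ac)
    also have "\<dots> = (\<Sum>j\<le>r. real (x choose j)
                        * (if j \<le> k then (-1) ^ j * real ((r - j) choose (k - j)) * c k else 0))"
      using xk by (intro sum.mono_neutral_cong_left) auto
    also have "\<dots> = (?P * ?U) $$ (x, k)"
      using xk by (simp add: scalar_prod_def atLeast0LessThan lessThan_Suc_atMost)
    finally show "(type_matrix n r * ?P) $$ (x, k) = (?P * ?U) $$ (x, k)" .
  qed (auto simp: type_matrix_def)
  \<comment> \<open>\<open>z choose k\<close> vanishes for \<open>k > z\<close> and is 1 for
    \<open>k = z\<close>, so \<open>?P\<close> is unitriangular.\<close>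
  have "Determinant.det ?P = prod_list (diag_mat ?P)"
    by (rule det_lower_triangular[of ?m]) auto
  then have "Determinant.det ?P \<noteq> 0" by (auto simp add: diag_mat_def prod_list_zero_iff)
  moreover have "upper_triangular ?U" by (rule upper_triangularI) auto
  ultimately have "eigenvalue (type_matrix n r) (?U $$ (k, k))"
    using QP assms(2)
    by (intro eigenvalue_of_intertwined_upper_triangular[OF type_matrix_carrier, of ?P]) auto
  then show ?thesis using assms(2) by (simp add: c_def)
qed

text \<open>Strictly decreasing absolute values give \<open>r + 1\<close> eigenvalues, and the
  dimension allows no more. Hence one eigenvector for each eigenvalue is enough for a basis.\<close>

lemma card_spectrum_type_matrix:
  assumes "2 * r < n"
  shows "card (spectrum (type_matrix n r)) = r + 1"
proof (rule antisym)
  let ?ev = "\<lambda>k. (-1) ^ k * real ((n - r - k) choose (r - k)) / real ((n - r) choose r)"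
  show "card (spectrum (type_matrix n r)) \<le> r + 1"
    by (rule card_finite_spectrum(2)[OF type_matrix_carrier])
  have abs: "\<bar>?ev k\<bar> = real ((n - r - k) choose (r - k)) / real ((n - r) choose r)" for k
    by (simp add: abs_mult power_abs)
  have "\<bar>?ev k\<bar> < \<bar>?ev j\<bar>" if "j < k" "k \<le> r" for j k
    unfolding abs using choose_diff_diff_strict_decreasing[of r "n - r" j k] that assms
    by (intro divide_strict_right_mono) auto
  then have "?ev j \<noteq> ?ev k" if "j < k" "k \<le> r" for j k
    using that by (metis less_irrefl)
  then have "inj_on ?ev {..r}"
    by (intro linorder_inj_onI) auto
  then have "r + 1 = card (?ev ` {..r})" by (simp add: card_image)
  also have "\<dots> \<le> card (spectrum (type_matrix n r))"
    using eigenvalue_type_matrix[OF assms]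
    by (intro card_mono card_finite_spectrum(1)[OF type_matrix_carrier]) (auto simp: spectrum_def)
  finally show "r + 1 \<le> card (spectrum (type_matrix n r))" .
qed


section \<open>The orthonormal eigenbasis and uniqueness of the invariant distribution\<close>

lemma one_in_spectrum_type_matrix:
  assumes "2 * r < n"
  shows "1 \<in> spectrum (type_matrix n r)"
proof -
  have "((n - r) choose r) \<noteq> 0" using assms by simp
  then show ?thesis using eigenvalue_type_matrix[OF assms, of 0] by (simp add: spectrum_def)
qed

text \<open>The family \<open>\<phi>\<close> is constrained only away from 1, so its value there is
  replaced by \<open>p\<close>, whose weighted inner product with itself is its total mass 1.
  Distinct eigenvalues give orthogonality.\<close>

lemma type_matrix_eigenbasis_orthonormal:
  fixes n r :: nat and \<phi> :: "real \<Rightarrow> real vec"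
  defines "p \<equiv> hypergeometric_vec n r" and "Q \<equiv> type_matrix n r"
  assumes nr: "2 * r < n"
    and \<phi>: "\<And>\<mu>. \<mu> \<in> spectrum Q - {1} \<Longrightarrow>
           \<phi> \<mu> \<in> carrier_vec (r + 1)
           \<and> transpose_mat Q *\<^sub>v \<phi> \<mu> = \<mu> \<cdot>\<^sub>v \<phi> \<mu>
           \<and> weighted_inner p (\<phi> \<mu>) (\<phi> \<mu>) = 1"
    and st: "s \<in> spectrum Q" "t \<in> spectrum Q"
  shows "weighted_inner p ((\<phi>(1 := p)) s) ((\<phi>(1 := p)) t) = (if s = t then 1 else 0)"
proof -
  let ?\<psi> = "\<phi>(1 := p)"
  have dim: "dim_vec p = r + 1" by (simp add: p_def)
  have pos: "vec_index p x > 0" if "x < dim_vec p" for x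
    using that hypergeometric_vec_pos[OF nr] by (simp add: p_def)
  have Q: "Q \<in> carrier_mat (dim_vec p) (dim_vec p)"
    unfolding dim Q_def by (rule type_matrix_carrier)
  have rev: "vec_index p x * Q $$ (x, z) = vec_index p z * Q $$ (z, x)"
    if "x < dim_vec p" "z < dim_vec p" for x z
    using that type_matrix_detailed_balance[OF nr] by (simp add: p_def Q_def)
  have "weighted_inner p p p = (\<Sum>x<dim_vec p. vec_index p x)"
    by (rule weighted_inner_right_weight[OF pos])
  also have "\<dots> = 1"
    using prob_vec_hypergeometric_vec[OF nr] unfolding prob_vec_def dim unfolding p_def by blast
  finally have p1: "weighted_inner p p p = 1" .
  have ev: "?\<psi> \<mu> \<in> carrier_vec (dim_vec p) \<and> transpose_mat Q *\<^sub>v ?\<psi> \<mu> = \<mu> \<cdot>\<^sub>v ?\<psi> \<mu>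
      \<and> weighted_inner p (?\<psi> \<mu>) (?\<psi> \<mu>) = 1" if "\<mu> \<in> spectrum Q" for \<mu>
  proof (cases "\<mu> = 1")
    case True
    then show ?thesis
      using p1 hypergeometric_vec_invariant[OF nr] unfolding Q_def p_def
      by (auto intro: carrier_vecI)
  next
    case False
    then show ?thesis using \<phi>[of \<mu>] that by (simp add: dim)
  qed
  show ?thesis
  proof (cases "s = t")
    case True
    then show ?thesis using ev[OF st(1)] by simp
  next
    case False
    then have "weighted_inner p (?\<psi> s) (?\<psi> t) = 0"
      using ev[OF st(1)] ev[OF st(2)] by (intro eigenvectors_weighted_orthogonal[where a = s and b = t, OF Q pos rev]) blast+
    then show ?thesis using False by simp
  qed
qed

text \<open>An invariant vector is orthogonal to every eigenvector for an eigenvalue other than 1,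
  so its expansion in the eigenbasis reduces to a multiple of \<open>hypergeometric_vec n r\<close>;
  the coefficient is its total mass 1.\<close>

lemma invariant_distribution_type_matrix:
  assumes nr: "2 * r < n" and inv: "invariant_distribution (type_matrix n r) \<pi>"
  shows "\<pi> = hypergeometric_vec n r"
proof -
  let ?Q = "type_matrix n r" and ?p = "hypergeometric_vec n r"
  have Q: "?Q \<in> carrier_mat (dim_vec ?p) (dim_vec ?p)"
    using type_matrix_carrier by simp
  have pos: "vec_index ?p x > 0" if "x < dim_vec ?p" for x
    using that hypergeometric_vec_pos[OF nr] by simp
  have rev: "vec_index ?p x * ?Q $$ (x, z) = vec_index ?p z * ?Q $$ (z, x)"
    if "x < dim_vec ?p" "z < dim_vec ?p" for x z
    using that type_matrix_detailed_balance[OF nr] by simp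
  have \<pi>: "\<pi> \<in> carrier_vec (dim_vec ?p)" "(\<Sum>x<dim_vec ?p. vec_index \<pi> x) = 1"
    "transpose_mat ?Q *\<^sub>v \<pi> = 1 \<cdot>\<^sub>v \<pi>"
    using inv type_matrix_carrier[of n r] unfolding invariant_distribution_def prob_vec_def by auto
  obtain \<phi> where \<phi>: "\<And>\<mu>. \<mu> \<in> spectrum ?Q \<Longrightarrow> \<phi> \<mu> \<in> carrier_vec (dim_vec ?p)
      \<and> transpose_mat ?Q *\<^sub>v \<phi> \<mu> = \<mu> \<cdot>\<^sub>v \<phi> \<mu> \<and> weighted_inner ?p (\<phi> \<mu>) (\<phi> \<mu>) = 1"
    using exists_normalized_left_eigenvector[OF Q pos] by metis
  let ?\<psi> = "\<phi>(1 := ?p)"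
  have ortho: "weighted_inner ?p (?\<psi> s) (?\<psi> t) = (if s = t then 1 else 0)"
    if "s \<in> spectrum ?Q" "t \<in> spectrum ?Q" for s t
    using \<phi> that by (intro type_matrix_eigenbasis_orthonormal[OF nr]) auto
  have zero: "weighted_inner ?p \<pi> (?\<psi> \<mu>) = 0" if "\<mu> \<in> spectrum ?Q - {1}" for \<mu>
    using that \<phi>[of \<mu>] eigenvectors_weighted_orthogonal[OF Q pos rev \<pi>(1,3), of "\<phi> \<mu>" \<mu>] by auto
  show ?thesis
  proof (rule eq_vecI)
    fix x assume x: "x < dim_vec ?p"
    have "vec_index \<pi> x = (\<Sum>\<mu>\<in>spectrum ?Q. weighted_inner ?p \<pi> (?\<psi> \<mu>) * vec_index (?\<psi> \<mu>) x)"
      using card_finite_spectrum(1)[OF Q] card_spectrum_type_matrix[OF nr]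
      by (intro weighted_orthonormal_expansion[OF pos _ _ ortho x]) auto
    also have "\<dots> = (\<Sum>\<mu>\<in>{1}. weighted_inner ?p \<pi> (?\<psi> \<mu>) * vec_index (?\<psi> \<mu>) x)"
      using card_finite_spectrum(1)[OF Q] one_in_spectrum_type_matrix[OF nr] zero
      by (intro sum.mono_neutral_right) auto
    also have "\<dots> = vec_index ?p x"
      by (simp add: weighted_inner_right_weight[OF pos] \<pi>(2) del: dim_hypergeometric_vec)
    finally show "vec_index \<pi> x = vec_index ?p x" .
  qed (use \<pi>(1) in auto)
qed


subsection \<open>The law of the chain on types\<close>

text \<open>The chain takes values in all of \<open>nat\<close>; the vector keeps the states up to
  \<open>r\<close>, and \<open>type_law_supported\<close> shows that no mass is lost.\<close>

definition type_law :: "nat \<Rightarrow> 'w measure \<Rightarrow> (nat \<Rightarrow> 'w \<Rightarrow> nat) \<Rightarrow> nat \<Rightarrow> real vec" where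
  "type_law r \<Omega> M t = Matrix.vec (r + 1) (\<lambda>x. \<P>(\<omega> in \<Omega>. M t \<omega> = x))"

lemma type_law_index [simp]:
  "x < r + 1 \<Longrightarrow> vec_index (type_law r \<Omega> M t) x = \<P>(\<omega> in \<Omega>. M t \<omega> = x)"
  "dim_vec (type_law r \<Omega> M t) = r + 1"
  by (simp_all add: type_law_def)

text \<open>The initial masses up to \<open>r\<close> already add up to 1, which leaves none
  elsewhere, and a step only reaches types up to \<open>r\<close>.\<close>

lemma type_law_supported:
  assumes mc: "markov_chain \<Omega> M (type_step n r)"
    and init: "(\<Sum>x<r + 1. \<P>(\<omega> in \<Omega>. M 0 \<omega> = x)) = 1"
    and "x \<notin> {..<r + 1}"
  shows "\<P>(\<omega> in \<Omega>. M t \<omega> = x) = 0"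
  using assms(3)
proof (induction t arbitrary: x)
  case 0
  have ps: "prob_space \<Omega>" and [measurable]: "\<And>t. M t \<in> measurable \<Omega> (count_space UNIV)"
    using mc unfolding markov_chain_def by auto
  interpret prob_space \<Omega> by (rule ps)
  have "(\<Sum>y\<in>insert x {..<r + 1}. prob {\<omega> \<in> space \<Omega>. M 0 \<omega> = y})
      = prob (\<Union>y\<in>insert x {..<r + 1}. {\<omega> \<in> space \<Omega>. M 0 \<omega> = y})"
    by (intro finite_measure_finite_Union[symmetric]) (auto simp: disjoint_family_on_def)
  also have "\<dots> \<le> 1" by (rule prob_le_1)
  finally have "prob {\<omega> \<in> space \<Omega>. M 0 \<omega> = x} \<le> 0"
    using 0 init by (subst (asm) sum.insert) auto
  then show ?case using measure_nonneg by (rule antisym)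
next
  case (Suc t)
  then have "pmf (type_step n r y) x = 0" for y by (intro pmf_type_step_eq_0) auto
  then show ?case
    using markov_chain_law_Suc[OF mc, of "{..<r + 1}" t x] Suc.IH by simp
qed

lemma type_law_Suc:
  assumes "markov_chain \<Omega> M (type_step n r)"
    and "(\<Sum>x<r + 1. \<P>(\<omega> in \<Omega>. M 0 \<omega> = x)) = 1"
  shows "type_law r \<Omega> M (Suc t) = transpose_mat (type_matrix n r) *\<^sub>v type_law r \<Omega> M t"
proof (rule eq_vecI)
  fix z assume "z < dim_vec (transpose_mat (type_matrix n r) *\<^sub>v type_law r \<Omega> M t)"
  then have z: "z < r + 1" by (simp add: type_matrix_def)
  have "vec_index (transpose_mat (type_matrix n r) *\<^sub>v type_law r \<Omega> M t) z
      = (\<Sum>x<r + 1. vec_index (type_law r \<Omega> M t) x * type_matrix n r $$ (x, z))"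
    using z by (intro transpose_mult_index[OF type_matrix_carrier]) (auto intro: carrier_vecI)
  also have "\<dots> = (\<Sum>x<r + 1. \<P>(\<omega> in \<Omega>. M t \<omega> = x) * pmf (type_step n r x) z)"
    using z by (intro sum.cong refl) (simp add: type_matrix_def)
  also have "\<dots> = \<P>(\<omega> in \<Omega>. M (Suc t) \<omega> = z)"
    by (rule markov_chain_law_Suc[OF assms(1) _ type_law_supported[OF assms], symmetric]) auto
  finally show "vec_index (type_law r \<Omega> M (Suc t)) z
      = vec_index (transpose_mat (type_matrix n r) *\<^sub>v type_law r \<Omega> M t) z"
    using z by simp
qed (simp add: type_matrix_def)

section \<open>Spectral expansion of the law and distance from equilibrium\<close>

theorem mainTheorem6:
  fixes n r :: nat
    and Q :: "real mat"
    and \<pi> \<theta> :: "real vec"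
    and \<phi> :: "real \<Rightarrow> real vec"
    and \<Omega> :: "'w measure"
    and M :: "nat \<Rightarrow> 'w \<Rightarrow> nat"
  assumes "n > 2 * r"
    and "Q = type_matrix n r"
    and "invariant_distribution Q \<pi>"
    and "\<And>\<mu>. \<mu> \<in> spectrum Q - {1} \<Longrightarrow>
           \<phi> \<mu> \<in> carrier_vec (r + 1)
           \<and> transpose_mat Q *\<^sub>v \<phi> \<mu> = \<mu> \<cdot>\<^sub>v \<phi> \<mu>
           \<and> weighted_inner \<pi> (\<phi> \<mu>) (\<phi> \<mu>) = 1"
    and "prob_vec (r + 1) \<theta>"
    and "markov_chain \<Omega> M (type_step n r)"
    and "\<And>x. x \<le> r \<Longrightarrow> \<P>(\<omega> in \<Omega>. M 0 \<omega> = x) = vec_index \<theta> x"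
  shows "\<exists>c :: real \<Rightarrow> real.
      (\<forall>x\<le>r. vec_index \<theta> x
             = vec_index \<pi> x + (\<Sum>\<mu>\<in>spectrum Q - {1}. c \<mu> * vec_index (\<phi> \<mu>) x))
    \<and> (\<forall>c'. (\<forall>x\<le>r. vec_index \<theta> x
             = vec_index \<pi> x + (\<Sum>\<mu>\<in>spectrum Q - {1}. c' \<mu> * vec_index (\<phi> \<mu>) x))
           \<longrightarrow> (\<forall>\<mu>\<in>spectrum Q - {1}. c' \<mu> = c \<mu>))
    \<and> (\<forall>t :: nat.
          (\<Sum>x\<le>r. (\<P>(\<omega> in \<Omega>. M t \<omega> = x) - vec_index \<pi> x)\<^sup>2 / vec_index \<pi> x)
            = (\<Sum>\<mu>\<in>spectrum Q - {1}. (c \<mu>)\<^sup>2 * \<mu> ^ (2 * t))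
        \<and> tv_dist (Matrix.vec (r + 1) (\<lambda>x. \<P>(\<omega> in \<Omega>. M t \<omega> = x))) \<pi>
            \<le> sqrt (real (r + 1)) / 2 * sqrt (\<Sum>\<mu>\<in>spectrum Q - {1}. (c \<mu>)\<^sup>2 * \<mu> ^ (2 * t)))"
proof -
  note nr = assms(1) and Q_eq = assms(2) and \<phi> = assms(4) and mc = assms(6) and init = assms(7)
  let ?S = "spectrum Q - {1}"
  have \<pi>_eq: "\<pi> = hypergeometric_vec n r"
    using invariant_distribution_type_matrix[OF nr] assms(3) Q_eq by simp
  have dim: "dim_vec \<pi> = r + 1" by (simp add: \<pi>_eq)
  have Q: "Q \<in> carrier_mat (dim_vec \<pi>) (dim_vec \<pi>)"
    unfolding dim Q_eq by (rule type_matrix_carrier)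
  have pos: "vec_index \<pi> x > 0" if "x < dim_vec \<pi>" for x
    using that hypergeometric_vec_pos[OF nr] by (simp add: \<pi>_eq)
  have rev: "vec_index \<pi> x * Q $$ (x, z) = vec_index \<pi> z * Q $$ (z, x)"
    if "x < dim_vec \<pi>" "z < dim_vec \<pi>" for x z
    using that type_matrix_detailed_balance[OF nr] by (simp add: \<pi>_eq Q_eq)
  have sum_\<pi>: "(\<Sum>x<dim_vec \<pi>. vec_index \<pi> x) = 1"
    using prob_vec_hypergeometric_vec[OF nr] by (simp add: prob_vec_def \<pi>_eq)
  have \<theta>: "\<theta> \<in> carrier_vec (dim_vec \<pi>)" "(\<Sum>x<dim_vec \<pi>. vec_index \<theta> x) = 1"
    using assms(5) by (simp_all add: prob_vec_def dim)
  have fin: "finite (spectrum Q)" by (rule card_finite_spectrum(1)[OF Q])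
  have card: "card (spectrum Q) = dim_vec \<pi>" using card_spectrum_type_matrix[OF nr] dim Q_eq by simp
  have one: "1 \<in> spectrum Q" using one_in_spectrum_type_matrix[OF nr] Q_eq by simp
  \<comment> \<open>Taking \<open>\<pi>\<close> as the eigenvector for 1 completes the family to an
    orthonormal basis indexed by the whole spectrum.\<close>
  define \<psi> where "\<psi> = \<phi>(1 := \<pi>)"
  have ortho: "weighted_inner \<pi> (\<psi> s) (\<psi> t) = (if s = t then 1 else 0)"
    if "s \<in> spectrum Q" "t \<in> spectrum Q" for s t
    using \<phi> that unfolding \<psi>_def \<pi>_eq Q_eq by (intro type_matrix_eigenbasis_orthonormal[OF nr]) auto
  have \<psi>S: "\<psi> \<mu> = \<phi> \<mu>" if "\<mu> \<in> ?S" for \<mu> using that by (auto simp: \<psi>_def)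
  have \<psi>1: "\<psi> 1 = \<pi>" by (simp add: \<psi>_def)
  have inner_\<pi>: "weighted_inner \<pi> u (\<psi> 1) = (\<Sum>x<dim_vec \<pi>. vec_index u x)" for u
    unfolding \<psi>1 by (rule weighted_inner_right_weight[OF pos])
  have \<pi>_orth: "weighted_inner \<pi> \<pi> (\<phi> \<mu>) = 0" if "\<mu> \<in> ?S" for \<mu>
    using ortho[of 1 \<mu>] that one \<psi>S[OF that] \<psi>1 by auto
  define c where "c \<mu> = weighted_inner \<pi> \<theta> (\<phi> \<mu>)" for \<mu>

  have expansion: "vec_index \<theta> x = vec_index \<pi> x + (\<Sum>\<mu>\<in>?S. c \<mu> * vec_index (\<phi> \<mu>) x)" if "x \<le> r" for x
  proof -
    have "vec_index \<theta> x = (\<Sum>\<mu>\<in>spectrum Q. weighted_inner \<pi> \<theta> (\<psi> \<mu>) * vec_index (\<psi> \<mu>) x)"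
      using that dim by (intro weighted_orthonormal_expansion[OF pos fin card ortho]) auto
    also have "\<dots> = weighted_inner \<pi> \<theta> (\<psi> 1) * vec_index (\<psi> 1) x
                  + (\<Sum>\<mu>\<in>?S. weighted_inner \<pi> \<theta> (\<psi> \<mu>) * vec_index (\<psi> \<mu>) x)"
      by (rule sum.remove[OF fin one])
    \<comment> \<open>The coefficient along \<open>\<psi> 1\<close> is the total mass of
      \<open>\<theta>\<close>, which is 1.\<close>
    also have "\<dots> = vec_index \<pi> x + (\<Sum>\<mu>\<in>?S. c \<mu> * vec_index (\<phi> \<mu>) x)"
      using inner_\<pi>[of \<theta>] \<theta>(2) by (simp add: \<psi>1 c_def \<psi>S)
    finally show ?thesis .
  qed
  have unique: "c' \<mu> = c \<mu>"
    if c': "\<forall>x\<le>r. vec_index \<theta> x = vec_index \<pi> x + (\<Sum>\<mu>\<in>?S. c' \<mu> * vec_index (\<phi> \<mu>) x)"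
      and \<mu>: "\<mu> \<in> ?S" for c' \<mu>
  proof -
    \<comment> \<open>Subtracting a vanishing inner product passes to
      \<open>\<theta> - \<pi>\<close>, which the assumed expansion writes in the
      \<open>\<phi> \<nu>\<close> alone; pairing with \<open>\<phi> \<mu>\<close> then isolates
      \<open>c' \<mu>\<close>.\<close>
    have "c \<mu> = weighted_inner \<pi> \<theta> (\<phi> \<mu>) - weighted_inner \<pi> \<pi> (\<phi> \<mu>)"
      by (simp add: c_def \<pi>_orth[OF \<mu>])
    also have "\<dots> = weighted_inner \<pi> (\<theta> - \<pi>) (\<phi> \<mu>)"
      using \<theta>(1) by (intro weighted_inner_minus_left[symmetric]) auto
    also have "\<dots> = (\<Sum>\<nu>\<in>?S. c' \<nu> * weighted_inner \<pi> (\<phi> \<nu>) (\<phi> \<mu>))"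
      using c' \<theta>(1) dim by (intro weighted_inner_sum_left) auto
    also have "\<dots> = (\<Sum>\<nu>\<in>?S. if \<nu> = \<mu> then c' \<nu> else 0)"
    proof (intro sum.cong refl)
      fix \<nu> assume "\<nu> \<in> ?S"
      then have "weighted_inner \<pi> (\<phi> \<nu>) (\<phi> \<mu>) = (if \<nu> = \<mu> then 1 else 0)"
        using ortho[of \<nu> \<mu>] \<mu> \<psi>S by simp
      then show "c' \<nu> * weighted_inner \<pi> (\<phi> \<nu>) (\<phi> \<mu>) = (if \<nu> = \<mu> then c' \<nu> else 0)"
        by simp
    qed
    also have "\<dots> = c' \<mu>" using fin \<mu> by simp
    finally show ?thesis by simp
  qed
  have L2: "weighted_inner \<pi> (type_law r \<Omega> M t - \<pi>) (type_law r \<Omega> M t - \<pi>)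
      = (\<Sum>\<mu>\<in>?S. (c \<mu>)\<^sup>2 * \<mu> ^ (2 * t))" for t
  proof -
    let ?f = "type_law r \<Omega> M"
    have init_sum: "(\<Sum>x<r + 1. \<P>(\<omega> in \<Omega>. M 0 \<omega> = x)) = 1"
      using \<theta>(2) init unfolding dim by (simp add: less_Suc_eq_le)
    have f0: "?f 0 = \<theta>"
      using init \<theta>(1) dim by (intro eq_vecI) auto
    have fc: "?f t \<in> carrier_vec (dim_vec \<pi>)" for t
      unfolding dim by (intro carrier_vecI) simp
    have fS: "?f (Suc t) = transpose_mat Q *\<^sub>v ?f t" for t
      unfolding Q_eq by (rule type_law_Suc[OF mc init_sum])
    have coeff: "weighted_inner \<pi> (?f t - \<pi>) (\<psi> \<mu>) = \<mu> ^ t * c \<mu>" if "\<mu> \<in> ?S" for \<mu>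
    proof -
      have "weighted_inner \<pi> (?f t) (\<phi> \<mu>) = \<mu> ^ t * weighted_inner \<pi> (?f 0) (\<phi> \<mu>)"
        using \<phi>[OF that] dim by (intro weighted_inner_transpose_pow[where f = ?f, OF Q pos rev _ _ fc fS]) auto
      then show ?thesis
        using \<pi>_orth[OF that] weighted_inner_minus_left[of "?f t" \<pi> \<pi> "\<phi> \<mu>"]
        by (simp add: \<psi>S[OF that] f0 c_def dim)
    qed
    \<comment> \<open>The coefficient along \<open>\<pi>\<close> is total mass, which the chain
      conserves because \<open>\<pi>\<close> has eigenvalue 1; hence the deviation from
      \<open>\<pi>\<close> has none.\<close>
    have coeff1: "weighted_inner \<pi> (?f t - \<pi>) (\<psi> 1) = 0"
    proof -
      have "weighted_inner \<pi> (?f t) \<pi> = 1 ^ t * weighted_inner \<pi> (?f 0) \<pi>"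
        using hypergeometric_vec_invariant[OF nr] dim
        by (intro weighted_inner_transpose_pow[where f = ?f, OF Q pos rev _ _ fc fS])
           (auto simp: \<pi>_eq Q_eq intro: carrier_vecI)
      then show ?thesis
        using inner_\<pi>[of \<theta>] inner_\<pi>[of \<pi>] \<theta>(2) sum_\<pi>
          weighted_inner_minus_left[of "?f t" \<pi> \<pi> \<pi>]
        by (simp add: \<psi>1 f0 dim)
    qed
    have "weighted_inner \<pi> (?f t - \<pi>) (?f t - \<pi>)
        = (\<Sum>\<mu>\<in>spectrum Q. (weighted_inner \<pi> (?f t - \<pi>) (\<psi> \<mu>))\<^sup>2)"
      by (rule weighted_parseval[OF pos fin card ortho])
    also have "\<dots> = (\<Sum>\<mu>\<in>?S. (weighted_inner \<pi> (?f t - \<pi>) (\<psi> \<mu>))\<^sup>2)"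
      by (simp add: sum.remove[OF fin one] coeff1)
    also have "\<dots> = (\<Sum>\<mu>\<in>?S. (c \<mu>)\<^sup>2 * \<mu> ^ (2 * t))"
      by (intro sum.cong refl) (simp add: coeff power_mult_distrib power_mult[symmetric] mult.commute)
    finally show ?thesis .
  qed
  have chi2: "(\<Sum>x\<le>r. (\<P>(\<omega> in \<Omega>. M t \<omega> = x) - vec_index \<pi> x)\<^sup>2 / vec_index \<pi> x)
      = weighted_inner \<pi> (type_law r \<Omega> M t - \<pi>) (type_law r \<Omega> M t - \<pi>)" for t
    unfolding weighted_inner_def dim lessThan_Suc_atMost[symmetric] Suc_eq_plus1
    by (intro sum.cong refl) (simp add: dim power2_eq_square)
  have tv: "tv_dist (type_law r \<Omega> M t) \<pi>
      \<le> sqrt (real (r + 1)) / 2 * sqrt (\<Sum>\<mu>\<in>?S. (c \<mu>)\<^sup>2 * \<mu> ^ (2 * t))" for t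
  proof -
    have "vec_index \<pi> x \<le> 1" if "x < dim_vec \<pi>" for x
      unfolding sum_\<pi>[symmetric] using that pos less_imp_le by (intro member_le_sum) auto
    then show ?thesis
      using tv_dist_le_weighted_norm[of "type_law r \<Omega> M t" \<pi>] pos unfolding L2 by (simp add: dim)
  qed
  show ?thesis
  proof (intro exI[of _ c] conjI allI impI ballI)
    show "vec_index \<theta> x = vec_index \<pi> x + (\<Sum>\<mu>\<in>?S. c \<mu> * vec_index (\<phi> \<mu>) x)" if "x \<le> r" for x
      by (rule expansion[OF that])
    show "c' \<mu> = c \<mu>"
      if "\<forall>x\<le>r. vec_index \<theta> x = vec_index \<pi> x + (\<Sum>\<mu>\<in>?S. c' \<mu> * vec_index (\<phi> \<mu>) x)"
        and "\<mu> \<in> ?S" for c' \<mu>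
      by (rule unique[OF that])
    show "(\<Sum>x\<le>r. (\<P>(\<omega> in \<Omega>. M t \<omega> = x) - vec_index \<pi> x)\<^sup>2 / vec_index \<pi> x)
        = (\<Sum>\<mu>\<in>?S. (c \<mu>)\<^sup>2 * \<mu> ^ (2 * t))" for t
      by (rule trans[OF chi2 L2])
    show "tv_dist (Matrix.vec (r + 1) (\<lambda>x. \<P>(\<omega> in \<Omega>. M t \<omega> = x))) \<pi>
        \<le> sqrt (real (r + 1)) / 2 * sqrt (\<Sum>\<mu>\<in>?S. (c \<mu>)\<^sup>2 * \<mu> ^ (2 * t))" for t
      using tv[of t] unfolding type_law_def .
  qed
qed

end
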